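(* Let $b:\mathcal H\to L_2(X,\mu)$ be a (generally non-linear) mapping such that, with some constant $c>0$, $\|b(v)\|_{L_2(X,\mu)}\le c(1+\|v\|_{\mathcal H})$ for all $v\in\mathrm{Im}\,\partial$. Assume that the embedding $\mathcal F\subset L_2(X,\mu)$ is compact. Then for any sufficiently large $\varrho>0$ there exists a weak solution to $$-Lu+b(\partial u)+\varrho u=0,$$ i.e. a function $u\in\mathcal F$ such that $\mathcal E(u,v)+\langle b(\partial u),v\rangle_{L_2(X,\mu)}+\varrho\langle u,v\rangle_{L_2(X,\mu)}=0$ for all $v\in\mathcal F$.
   Context: $X$ is a locally compact separable metric space, $\mu$ a nonnegative Radon measure on $X$ with $\mu(U)>0$ for every nonempty open $U$, and $(\mathcal E,\mathcal F)$ a regular symmetric Dirichlet form on $L_2(X,\mu)$, with infinitesimal generator $L$; $\mathcal E(f)=\mathcal E(f,f)$, and $\mathcal F$ carries the norm $\mathcal E_1(f)^{1/2}$, $\mathcal E_1(f)=\mathcal E(f)+\|f\|_{L_2(X,\mu)}^2$. $C_0(X)$ is the space of continuous compactly supported functions, $\mathcal C:=C_0(X)\cap\mathcal F$, $\mathcal B_b(X)$ the space of bounded Borel functions. Energy measures: for $g,h\in\mathcal C$, $\Gamma(g,h)$ is the unique finite signed Radon measure with $2\int_X f\,d\Gamma(g,h)=\mathcal E(fg,h)+\mathcal E(fh,g)-\mathcal E(gh,f)$ for all $f\in\mathcal C$; $\Gamma(g):=\Gamma(g,g)\ge0$. Standing assumption: $\Gamma(g,h)(X)=\mathcal E(g,h)$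 for all $g,h\in\mathcal C$. The space $\mathcal H$: on $\mathcal C\otimes\mathcal B_b(X)$ consider the nonnegative definite symmetric bilinear form determined by $\langle a\otimes b,c\otimes d\rangle_{\mathcal H}:=\int_X bd\,d\Gamma(a,c)$, with seminorm $\|\cdot\|_{\mathcal H}$. $\mathcal H$ is the Hilbert space completion of $\mathcal C\otimes\mathcal B_b(X)/\ker\|\cdot\|_{\mathcal H}$. The gradient $\partial f:=f\otimes\mathbf 1$, $f\in\mathcal C$, extends uniquely to a closed linear operator $\partial:L_2(X,\mu)\to\mathcal H$ with domain $\mathcal F$; $\mathrm{Im}\,\partial$ is the image of $\mathcal F$ under $\partial$.
   Formalization: The mapping b is additionally assumed continuous on Im ∂ (from the norm of H to the norm of L_2(X,μ)); for discontinuous b the claim fails, e.g. on a two-point space with a bounded b that jumps with the sign of u(0)-u(1). *)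

theory Defs
  imports "HOL-Analysis.Analysis"
begin

subsection \<open>Radon measures and finite signed Radon measures\<close>

text \<open>A Radon measure is a Borel measure that is finite on compact sets and inner regular
  with respect to compact sets.\<close>

definition radon_measure :: "'a::topological_space measure \<Rightarrow> bool" where
  "radon_measure M \<longleftrightarrow>
     sets M = sets borel \<and>
     (\<forall>K. compact K \<longrightarrow> emeasure M K < \<infinity>) \<and>
     (\<forall>A\<in>sets borel. emeasure M A = (SUP K\<in>{K\<in>sets borel. K \<subseteq> A \<and> compact K}. emeasure M K))"

text \<open>A finite signed measure is a real-valued set function, of which only the values on Borel
  sets matter. By the Jordan decomposition, the finite signed Radon measures are the differences
  of two finite Radon measures.\<close>

definition difference_of ::
    "('a::topological_space set \<Rightarrow> real) \<Rightarrow> 'a measure \<Rightarrow> 'a measure \<Rightarrow> bool" where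
  "difference_of \<nu> P N \<longleftrightarrow>
     radon_measure P \<and> finite_measure P \<and> radon_measure N \<and> finite_measure N \<and>
     (\<forall>A\<in>sets borel. \<nu> A = measure P A - measure N A)"

definition signed_radon_measure :: "('a::topological_space set \<Rightarrow> real) \<Rightarrow> bool" where
  "signed_radon_measure \<nu> \<longleftrightarrow> (\<exists>P N. difference_of \<nu> P N)"

text \<open>The integral does not depend on the decomposition used, at least for bounded Borel
  functions, which are the only integrands below; see \<open>signed_integral_eq\<close>.\<close>

definition signed_integral :: "('a::topological_space set \<Rightarrow> real) \<Rightarrow> ('a \<Rightarrow> real) \<Rightarrow> real" where
  "signed_integral \<nu> f =
     (case (SOME (P, N). difference_of \<nu> P N) of (P, N) \<Rightarrow> (LINT x|P. f x) - (LINT x|N. f x))"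

definition bounded_borel :: "('a::topological_space \<Rightarrow> real) set" where
  "bounded_borel = {f \<in> borel_measurable borel. bounded (range f)}"

lemma nn_integral_sum_unique:
  fixes f :: "'a::topological_space \<Rightarrow> ennreal"
  assumes f: "f \<in> borel_measurable borel"
    and s [measurable_cong]: "sets P = sets borel" "sets N = sets borel" "sets P' = sets borel" "sets N' = sets borel"
    and e: "\<And>A. A \<in> sets borel \<Longrightarrow> emeasure P A + emeasure N' A = emeasure P' A + emeasure N A"
  shows "(\<integral>\<^sup>+x. f x \<partial>P) + (\<integral>\<^sup>+x. f x \<partial>N') = (\<integral>\<^sup>+x. f x \<partial>P') + (\<integral>\<^sup>+x. f x \<partial>N)"
  using f
proof (induct rule: borel_measurable_induct)
  case (cong f g)
  then show ?case by (simp add: fun_eq_iff)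
next
  case (set A)
  then show ?case using e s by simp
next
  case (mult u c)
  have "u \<in> borel_measurable M" if "sets M = sets borel" for M
    using mult that measurable_cong_sets by blast
  then show ?case using mult s by (simp add: nn_integral_cmult distrib_left [symmetric])
next
  case (add u v)
  have m: "u \<in> borel_measurable M" "v \<in> borel_measurable M" if "sets M = sets borel" for M
    using add that measurable_cong_sets by blast+
  have "(\<integral>\<^sup>+x. v x + u x \<partial>M) = (\<integral>\<^sup>+x. v x \<partial>M) + (\<integral>\<^sup>+x. u x \<partial>M)" if "sets M = sets borel" for M
    using m[OF that] by (simp add: nn_integral_add)
  then show ?case using add.hyps(3,7) s by (simp add: add_ac)
next
  case (seq U)
  have m: "U i \<in> borel_measurable M" if "sets M = sets borel" for M i
    using seq that measurable_cong_sets by blast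
  have lim: "(\<lambda>i. \<integral>\<^sup>+x. U i x \<partial>M) \<longlonglongrightarrow> (\<integral>\<^sup>+x. (SUP i. U i) x \<partial>M)" if "sets M = sets borel" for M
  proof -
    have "(\<integral>\<^sup>+x. (SUP i. U i) x \<partial>M) = (SUP i. \<integral>\<^sup>+x. U i x \<partial>M)"
      using nn_integral_monotone_convergence_SUP[OF \<open>incseq U\<close>, of M] m[OF that]
      by (simp add: image_comp)
    moreover have "incseq (\<lambda>i. \<integral>\<^sup>+x. U i x \<partial>M)"
      using \<open>incseq U\<close> by (auto simp: incseq_def le_fun_def intro!: nn_integral_mono)
    ultimately show ?thesis by (simp add: LIMSEQ_SUP)
  qed
  have "(\<lambda>i. (\<integral>\<^sup>+x. U i x \<partial>P) + (\<integral>\<^sup>+x. U i x \<partial>N')) \<longlonglongrightarrow>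
      (\<integral>\<^sup>+x. (SUP i. U i) x \<partial>P) + (\<integral>\<^sup>+x. (SUP i. U i) x \<partial>N')"
    using lim s by (intro tendsto_add) auto
  moreover have "(\<lambda>i. (\<integral>\<^sup>+x. U i x \<partial>P') + (\<integral>\<^sup>+x. U i x \<partial>N)) \<longlonglongrightarrow>
      (\<integral>\<^sup>+x. (SUP i. U i) x \<partial>P') + (\<integral>\<^sup>+x. (SUP i. U i) x \<partial>N)"
    using lim s by (intro tendsto_add) auto
  ultimately show ?case using seq LIMSEQ_unique by simp
qed

lemma integrable_bounded_borel:
  assumes "finite_measure M" "sets M = sets borel" "f \<in> bounded_borel"
  shows "integrable M f"
proof -
  interpret finite_measure M by fact
  obtain B where "\<And>x. norm (f x) \<le> B"
    using assms(3) by (auto simp: bounded_borel_def bounded_iff)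
  then show ?thesis
    using assms by (intro integrable_const_bound[of _ B])
      (auto simp: bounded_borel_def cong: measurable_cong_sets)
qed

lemma signed_integral_eq:
  assumes d: "difference_of \<nu> P N" and f: "f \<in> bounded_borel"
  shows "signed_integral \<nu> f = (LINT x|P. f x) - (LINT x|N. f x)"
proof -
  obtain P' N' where PN: "(SOME (P, N). difference_of \<nu> P N) = (P', N')"
    by (cases "SOME (P, N). difference_of \<nu> P N")
  have d': "difference_of \<nu> P' N'"
    using someI[of "\<lambda>(P, N). difference_of \<nu> P N" "(P, N)"] d by (simp add: PN)
  have s: "sets P = sets borel" "sets N = sets borel" "sets P' = sets borel" "sets N' = sets borel"
    and fin: "finite_measure P" "finite_measure N" "finite_measure P'" "finite_measure N'"
    using d d' by (auto simp: difference_of_def radon_measure_def)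
  have m: "measure P A + measure N' A = measure P' A + measure N A" if "A \<in> sets borel" for A
    using d d' that by (fastforce simp: difference_of_def)
  have e: "emeasure P A + emeasure N' A = emeasure P' A + emeasure N A" if "A \<in> sets borel" for A
    using m[OF that] fin by (simp add: finite_measure.emeasure_eq_measure flip: ennreal_plus)
  obtain B where B: "\<And>x. \<bar>f x\<bar> \<le> B"
    using f by (auto simp: bounded_borel_def bounded_iff)
  define g where "g x = f x + B" for x
  have g0: "g x \<ge> 0" for x using B[of x] by (simp add: g_def abs_le_iff)
  have gm: "g \<in> borel_measurable borel"
    using f unfolding g_def by (auto simp: bounded_borel_def)
  have gi: "integrable M g" "(LINT x|M. g x) = (LINT x|M. f x) + B * measure M UNIV"
    "(\<integral>\<^sup>+x. ennreal (g x) \<partial>M) = ennreal (LINT x|M. g x)"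
    if "finite_measure M" "sets M = sets borel" for M
  proof -
    interpret finite_measure M by fact
    have "space M = UNIV" using sets_eq_imp_space_eq[OF that(2)] by simp
    then show i: "integrable M g" "(LINT x|M. g x) = (LINT x|M. f x) + B * measure M UNIV"
      using integrable_bounded_borel[OF that f] unfolding g_def by auto
    show "(\<integral>\<^sup>+x. ennreal (g x) \<partial>M) = ennreal (LINT x|M. g x)"
      using i g0 by (intro nn_integral_eq_integral) auto
  qed
  have "(\<integral>\<^sup>+x. ennreal (g x) \<partial>P) + (\<integral>\<^sup>+x. ennreal (g x) \<partial>N') =
      (\<integral>\<^sup>+x. ennreal (g x) \<partial>P') + (\<integral>\<^sup>+x. ennreal (g x) \<partial>N)"
    using gm by (intro nn_integral_sum_unique s e) auto
  then have "ennreal ((LINT x|P. g x) + (LINT x|N'. g x)) = ennreal ((LINT x|P'. g x) + (LINT x|N. g x))"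
    using gi(3)[OF fin(1) s(1)] gi(3)[OF fin(2) s(2)] gi(3)[OF fin(3) s(3)] gi(3)[OF fin(4) s(4)] g0
    by (simp add: integral_nonneg ennreal_plus)
  then have "(LINT x|P. g x) + (LINT x|N'. g x) = (LINT x|P'. g x) + (LINT x|N. g x)"
    using g0 by (subst (asm) ennreal_inj) (auto intro!: add_nonneg_nonneg integral_nonneg)
  moreover have "B * measure P UNIV + B * measure N' UNIV = B * measure P' UNIV + B * measure N UNIV"
    using m[of UNIV] by (simp flip: distrib_left)
  ultimately have "(LINT x|P. f x) - (LINT x|N. f x) = (LINT x|P'. f x) - (LINT x|N'. f x)"
    using gi(2)[OF fin(1) s(1)] gi(2)[OF fin(2) s(2)] gi(2)[OF fin(3) s(3)] gi(2)[OF fin(4) s(4)]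
    by linarith
  then show ?thesis by (simp add: signed_integral_def PN)
qed


subsection \<open>Dirichlet forms\<close>

text \<open>Elements of L2 are represented by square integrable Borel functions. Functions that agree
  almost everywhere represent the same element, so equality of elements, limits and
  completeness are understood up to almost everywhere equality, i.e. with respect to the
  seminorm \<open>L2_norm\<close>.\<close>

definition L2 :: "'a measure \<Rightarrow> ('a \<Rightarrow> real) set" where
  "L2 M = {f \<in> borel_measurable M. integrable M (\<lambda>x. (f x)\<^sup>2)}"

definition L2_inner :: "'a measure \<Rightarrow> ('a \<Rightarrow> real) \<Rightarrow> ('a \<Rightarrow> real) \<Rightarrow> real" where
  "L2_inner M f g = (LINT x|M. f x * g x)"

definition L2_norm :: "'a measure \<Rightarrow> ('a \<Rightarrow> real) \<Rightarrow> real" where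
  "L2_norm M f = sqrt (L2_inner M f f)"

definition E1 :: "'a measure \<Rightarrow> (('a \<Rightarrow> real) \<Rightarrow> ('a \<Rightarrow> real) \<Rightarrow> real) \<Rightarrow> ('a \<Rightarrow> real) \<Rightarrow> real" where
  "E1 M E f = E f f + (L2_norm M f)\<^sup>2"

text \<open>The third conjunct says that the domain and the form are well defined on classes
  of functions modulo almost everywhere equality.\<close>

definition dirichlet_form ::
    "'a measure \<Rightarrow> ('a \<Rightarrow> real) set \<Rightarrow> (('a \<Rightarrow> real) \<Rightarrow> ('a \<Rightarrow> real) \<Rightarrow> real) \<Rightarrow> bool" where
  "dirichlet_form M F E \<longleftrightarrow>
     F \<subseteq> L2 M \<and>
     ((\<lambda>x. 0) \<in> F \<and> (\<forall>u\<in>F. \<forall>v\<in>F. (\<lambda>x. u x + v x) \<in> F) \<and> (\<forall>r. \<forall>u\<in>F. (\<lambda>x. r * u x) \<in> F)) \<and>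
     (\<forall>u\<in>F. \<forall>v\<in>borel_measurable M. (AE x in M. u x = v x) \<longrightarrow>
        v \<in> F \<and> (\<forall>w\<in>F. E v w = E u w)) \<and>
     \<comment> \<open>densely defined\<close>
     (\<forall>f\<in>L2 M. \<forall>\<epsilon>>0. \<exists>u\<in>F. L2_norm M (\<lambda>x. f x - u x) < \<epsilon>) \<and>
     \<comment> \<open>symmetric, bilinear, nonnegative definite\<close>
     (\<forall>u\<in>F. \<forall>v\<in>F. E u v = E v u) \<and>
     (\<forall>u\<in>F. \<forall>v\<in>F. \<forall>w\<in>F. E (\<lambda>x. u x + v x) w = E u w + E v w) \<and>
     (\<forall>r. \<forall>u\<in>F. \<forall>w\<in>F. E (\<lambda>x. r * u x) w = r * E u w) \<and>
     (\<forall>u\<in>F. 0 \<le> E u u) \<and>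
     \<comment> \<open>closed\<close>
     (\<forall>u. (\<forall>n. u n \<in> F) \<and>
        (\<forall>\<epsilon>>0. \<exists>k::nat. \<forall>m\<ge>k. \<forall>n\<ge>k. E1 M E (\<lambda>x. u m x - u n x) < \<epsilon>) \<longrightarrow>
        (\<exists>v\<in>F. (\<lambda>n. E1 M E (\<lambda>x. u n x - v x)) \<longlonglongrightarrow> 0)) \<and>
     \<comment> \<open>Markovian\<close>
     (\<forall>u\<in>F. (\<lambda>x. min (max (u x) 0) 1) \<in> F \<and>
        E (\<lambda>x. min (max (u x) 0) 1) (\<lambda>x. min (max (u x) 0) 1) \<le> E u u)"

definition cont_cpt_supp :: "('a::topological_space \<Rightarrow> real) set" where
  "cont_cpt_supp = {f. continuous_on UNIV f \<and> compact (closure {x. f x \<noteq> 0})}"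

definition core :: "('a::topological_space \<Rightarrow> real) set \<Rightarrow> ('a \<Rightarrow> real) set" where
  "core F = cont_cpt_supp \<inter> F"

definition regular_form ::
    "'a::topological_space measure \<Rightarrow> ('a \<Rightarrow> real) set \<Rightarrow> (('a \<Rightarrow> real) \<Rightarrow> ('a \<Rightarrow> real) \<Rightarrow> real) \<Rightarrow> bool"
  where
  "regular_form M F E \<longleftrightarrow>
     (\<forall>u\<in>F. \<forall>\<epsilon>>0. \<exists>g\<in>core F. E1 M E (\<lambda>x. u x - g x) < \<epsilon>) \<and>
     (\<forall>f\<in>cont_cpt_supp. \<forall>\<epsilon>>0. \<exists>g\<in>core F. \<forall>x. \<bar>f x - g x\<bar> < \<epsilon>)"

definition compactly_embedded ::
    "'a measure \<Rightarrow> ('a \<Rightarrow> real) set \<Rightarrow> (('a \<Rightarrow> real) \<Rightarrow> ('a \<Rightarrow> real) \<Rightarrow> real) \<Rightarrow> bool" where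
  "compactly_embedded M F E \<longleftrightarrow>
     (\<forall>u. (\<forall>n::nat. u n \<in> F) \<and> (\<exists>K. \<forall>n. E1 M E (u n) \<le> K) \<longrightarrow>
        (\<exists>f\<in>L2 M. \<exists>r. strict_mono r \<and> (\<lambda>n. L2_norm M (\<lambda>x. u (r n) x - f x)) \<longlonglongrightarrow> 0))"


subsection \<open>Energy measures, the space H and the gradient\<close>

text \<open>For a regular Dirichlet form the energy measures exist and are uniquely determined on
  Borel sets by this property.\<close>

definition energy_measures ::
    "('a::topological_space \<Rightarrow> real) set \<Rightarrow> (('a \<Rightarrow> real) \<Rightarrow> ('a \<Rightarrow> real) \<Rightarrow> real) \<Rightarrow>
     (('a \<Rightarrow> real) \<Rightarrow> ('a \<Rightarrow> real) \<Rightarrow> 'a set \<Rightarrow> real) \<Rightarrow> bool" where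
  "energy_measures F E \<Gamma> \<longleftrightarrow>
     (\<forall>g\<in>core F. \<forall>h\<in>core F.
        signed_radon_measure (\<Gamma> g h) \<and>
        (\<forall>f\<in>core F. 2 * signed_integral (\<Gamma> g h) f =
           E (\<lambda>x. f x * g x) h + E (\<lambda>x. f x * h x) g - E (\<lambda>x. g x * h x) f))"

text \<open>The Hilbert space H is the type \<open>'h\<close>, and \<open>tensor a b\<close> is the class in H of the elementary
  tensor of \<open>a\<close> (in the core) and \<open>b\<close> (bounded Borel). By the universal property of the algebraic
  tensor product the bilinear map \<open>tensor\<close> is the same thing as a linear map on the tensor product
  of the two spaces. The condition on inner products says that this linear map is isometric for
  the seminorm of H, hence injective modulo its kernel, and the last condition says that its range,
  the span of the elementary tensors, is dense in the complete space \<open>'h\<close>. So \<open>'h\<close> with \<open>tensor\<close>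
  is an arbitrary realization of the completion, which is unique up to isometric isomorphism.\<close>

definition is_H_completion ::
    "('a::topological_space \<Rightarrow> real) set \<Rightarrow> (('a \<Rightarrow> real) \<Rightarrow> ('a \<Rightarrow> real) \<Rightarrow> 'a set \<Rightarrow> real) \<Rightarrow>
     (('a \<Rightarrow> real) \<Rightarrow> ('a \<Rightarrow> real) \<Rightarrow> 'h::{real_inner, complete_space}) \<Rightarrow> bool" where
  "is_H_completion F \<Gamma> tensor \<longleftrightarrow>
     (\<forall>a\<in>core F. \<forall>a'\<in>core F. \<forall>b\<in>bounded_borel.
        tensor (\<lambda>x. a x + a' x) b = tensor a b + tensor a' b) \<and>
     (\<forall>r. \<forall>a\<in>core F. \<forall>b\<in>bounded_borel. tensor (\<lambda>x. r * a x) b = r *\<^sub>R tensor a b) \<and>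
     (\<forall>a\<in>core F. \<forall>b\<in>bounded_borel. \<forall>b'\<in>bounded_borel.
        tensor a (\<lambda>x. b x + b' x) = tensor a b + tensor a b') \<and>
     (\<forall>r. \<forall>a\<in>core F. \<forall>b\<in>bounded_borel. tensor a (\<lambda>x. r * b x) = r *\<^sub>R tensor a b) \<and>
     (\<forall>a\<in>core F. \<forall>b\<in>bounded_borel. \<forall>c\<in>core F. \<forall>d\<in>bounded_borel.
        inner (tensor a b) (tensor c d) = signed_integral (\<Gamma> a c) (\<lambda>x. b x * d x)) \<and>
     closure (span {tensor a b |a b. a \<in> core F \<and> b \<in> bounded_borel}) = UNIV"

text \<open>\<open>D\<close> is a closed linear operator from L2 to H with domain \<open>F\<close> that extends \<open>f \<mapsto> tensor f 1\<close>.
  Closedness, applied to constant sequences, makes \<open>D\<close> well defined on classes modulo almost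
  everywhere equality.\<close>

definition is_gradient ::
    "'a::topological_space measure \<Rightarrow> ('a \<Rightarrow> real) set \<Rightarrow>
     (('a \<Rightarrow> real) \<Rightarrow> ('a \<Rightarrow> real) \<Rightarrow> 'h::{real_inner, complete_space}) \<Rightarrow>
     (('a \<Rightarrow> real) \<Rightarrow> 'h) \<Rightarrow> bool" where
  "is_gradient M F tensor D \<longleftrightarrow>
     (\<forall>f\<in>core F. D f = tensor f (\<lambda>x. 1)) \<and>
     (\<forall>u\<in>F. \<forall>v\<in>F. D (\<lambda>x. u x + v x) = D u + D v) \<and>
     (\<forall>r. \<forall>u\<in>F. D (\<lambda>x. r * u x) = r *\<^sub>R D u) \<and>
     (\<forall>u. \<forall>f\<in>L2 M. \<forall>h. (\<forall>n::nat. u n \<in> F) \<and>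
        (\<lambda>n. L2_norm M (\<lambda>x. u n x - f x)) \<longlonglongrightarrow> 0 \<and> (\<lambda>n. D (u n)) \<longlonglongrightarrow> h \<longrightarrow>
        f \<in> F \<and> D f = h)"

text \<open>Sequential continuity of a map from H to L2 on the subset \<open>S\<close> of H, for the norm topologies.
  Existence of weak solutions needs some continuity of the nonlinearity. On the two-point space
  with counting measure and \<open>E u v = (u 0 - u 1) * (v 0 - v 1)\<close>, the space H contains the line
  of gradients \<open>D u\<close>, determined by \<open>s = u 0 - u 1\<close>. Let \<open>b (D u) = (-1, 1)\<close> if \<open>s \<le> 0\<close> and
  \<open>b (D u) = (1, -1)\<close> if \<open>s > 0\<close>, which is bounded. Testing with \<open>v = (1, -1)\<close> gives
  \<open>(2 + \<rho>) * s = 2\<close> if \<open>s \<le> 0\<close> and \<open>(2 + \<rho>) * s = - 2\<close> if \<open>s > 0\<close>, so there is no weak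
  solution for any \<open>\<rho> > 0\<close>.\<close>

definition L2_continuous_on ::
    "'a measure \<Rightarrow> 'h::real_normed_vector set \<Rightarrow> ('h \<Rightarrow> 'a \<Rightarrow> real) \<Rightarrow> bool" where
  "L2_continuous_on M S b \<longleftrightarrow>
     (\<forall>w v. (\<forall>n::nat. w n \<in> S) \<and> v \<in> S \<and> w \<longlonglongrightarrow> v \<longrightarrow>
        (\<lambda>n. L2_norm M (\<lambda>x. b (w n) x - b v x)) \<longlonglongrightarrow> 0)"

text \<open>Weak solutions of \<open>- L u + b (D u) + \<rho> u = 0\<close>, where \<open>L\<close> is the generator of the form.\<close>

definition weak_solution ::
    "'a measure \<Rightarrow> ('a \<Rightarrow> real) set \<Rightarrow> (('a \<Rightarrow> real) \<Rightarrow> ('a \<Rightarrow> real) \<Rightarrow> real) \<Rightarrow>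
     (('a \<Rightarrow> real) \<Rightarrow> 'h) \<Rightarrow> ('h \<Rightarrow> 'a \<Rightarrow> real) \<Rightarrow> real \<Rightarrow> ('a \<Rightarrow> real) \<Rightarrow> bool" where
  "weak_solution M F E D b \<rho> u \<longleftrightarrow>
     u \<in> F \<and> (\<forall>v\<in>F. E u v + L2_inner M (b (D u)) v + \<rho> * L2_inner M u v = 0)"

end

theory Submission
  imports Defs
begin

text \<open>The equation is a fixed point problem for gradients. Let
\<open>E\<^sub>\<rho>(u, v) = E(u, v) + \<rho> \<langle>u, v\<rangle>\<close>, which for \<open>\<rho> > 0\<close> is an inner product on \<open>F\<close>
modulo almost everywhere equality, complete because the form is closed. Given a gradient \<open>w\<close>, the Riesz theorem yields \<open>R w \<in> F\<close> with
\<open>E\<^sub>\<rho>(R w, v) = - \<langle>b w, v\<rangle>\<close> for all \<open>v \<in> F\<close>, and \<open>u = R w\<close> is a weak solution as soon as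
\<open>D (R w) = w\<close>. Such a \<open>w\<close> is found with Schauder's fixed point theorem.

The invariant set consists of the gradients of the functions \<open>u \<in> F\<close> with
\<open>\<bar>E\<^sub>\<rho>(u, v)\<bar> \<le> 2 c \<parallel>v\<parallel>\<close> for all \<open>v \<in> F\<close>, the norm being that of \<open>L\<^sup>2\<close>
(\<open>resolvent_ball\<close>). Testing with \<open>v = u\<close> gives \<open>E(u, u) + \<rho> \<parallel>u\<parallel>\<^sup>2 \<le> 2 c \<parallel>u\<parallel>\<close>, hence
\<open>E(u, u) \<le> c\<^sup>2 / \<rho>\<close>. The gradient is isometric, \<open>\<parallel>D u\<parallel>\<^sup>2 = E(u, u)\<close> (\<open>gradient_isometry\<close>), so for
\<open>\<rho> \<ge> c\<^sup>2\<close> all these gradients \<open>w\<close> lie in the unit ball, where the growth condition reads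
\<open>\<parallel>b w\<parallel> \<le> 2 c\<close>; so \<open>w \<mapsto> D (R w)\<close> maps the set into itself. The set is convex, and it is compact
(\<open>compact_resolvent_ball\<close>): a sequence in it is bounded in \<open>F\<close>, so a subsequence \<open>u\<^sub>n\<close> converges in
\<open>L\<^sup>2\<close>, and then \<open>E\<^sub>\<rho>(u\<^sub>m - u\<^sub>n, u\<^sub>m - u\<^sub>n) \<le> 4 c \<parallel>u\<^sub>m - u\<^sub>n\<parallel>\<close> shows that it even converges in \<open>F\<close>.
The same estimate as above bounds \<open>\<parallel>D (R w) - D (R z)\<parallel>\<close> by a multiple of \<open>\<parallel>b w - b z\<parallel>\<close>, so the map
is continuous.

Schauder's theorem is reduced to Brouwer's theorem for the cube \<open>[0, 1]\<^sup>n\<close>. Since \<open>n\<close> is the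
size of a net and varies with its fineness, the points of the cube are functions on \<open>nat\<close> of
which only the first \<open>n\<close> values matter, and Brouwer's theorem is derived for them directly from
Kuhn's combinatorial lemma.\<close>

section \<open>The fixed point theorems of Brouwer and Schauder\<close>

lemma unit_cube_convergent_subsequence:
  fixes X :: "nat \<Rightarrow> nat \<Rightarrow> real"
  assumes "\<And>k i. i < n \<Longrightarrow> 0 \<le> X k i \<and> X k i \<le> 1"
  shows "\<exists>r x. strict_mono (r :: nat \<Rightarrow> nat) \<and> (\<forall>i<n. (\<lambda>k. X (r k) i) \<longlonglongrightarrow> x i)"
  using assms
proof (induction n)
  case 0
  show ?case by (auto intro: exI[of _ "\<lambda>k. k"] simp: strict_mono_def)
next
  case (Suc n)
  then obtain r x where r: "strict_mono (r :: nat \<Rightarrow> nat)" "\<And>i. i < n \<Longrightarrow> (\<lambda>k. X (r k) i) \<longlonglongrightarrow> x i"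
    by (metis less_Suc_eq)
  have "X (r k) n \<in> {0..1}" for k using Suc.prems by auto
  then obtain y s where s: "strict_mono (s :: nat \<Rightarrow> nat)" "((\<lambda>k. X (r k) n) \<circ> s) \<longlonglongrightarrow> y"
    using compact_Icc[of "0::real" 1] unfolding compact_eq_seq_compact_metric seq_compact_def by metis
  have "(\<lambda>k. X ((r \<circ> s) k) i) \<longlonglongrightarrow> (x(n := y)) i" if "i < Suc n" for i
  proof (cases "i = n")
    case True
    then show ?thesis using s(2) by (simp add: o_def)
  next
    case False
    then have "i < n" using that by simp
    then show ?thesis using LIMSEQ_subseq_LIMSEQ[OF r(2)[of i] s(1)] False by (simp add: o_def)
  qed
  then show ?case using strict_mono_o[OF r(1) s(1)] by blast
qed

text \<open>Kuhn's lemma is applied to the grid of mesh \<open>1 / Suc k\<close>, where the label of a grid point in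
direction \<open>i\<close> records the sign of the \<open>i\<close>-th coordinate of \<open>f x - x\<close>. It yields a cell in which
each coordinate has both signs. A limit of such cells as \<open>k\<close> tends to infinity is a fixed point.
The maps needed here are given by formulas in the coordinates, for which continuity along
coordinatewise convergent sequences is immediate.\<close>

lemma brouwer_unit_cube:
  fixes f :: "(nat \<Rightarrow> real) \<Rightarrow> nat \<Rightarrow> real"
  assumes maps: "\<And>x i. (\<And>j. j < n \<Longrightarrow> 0 \<le> x j \<and> x j \<le> 1) \<Longrightarrow> i < n \<Longrightarrow> 0 \<le> f x i \<and> f x i \<le> 1"
    and cont: "\<And>X x i. (\<And>k j. j < n \<Longrightarrow> 0 \<le> X k j \<and> X k j \<le> 1) \<Longrightarrow>
        (\<And>j. j < n \<Longrightarrow> (\<lambda>k. X k j) \<longlonglongrightarrow> x j) \<Longrightarrow> i < n \<Longrightarrow> (\<lambda>k. f (X k) i) \<longlonglongrightarrow> f x i"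
  obtains x where "\<And>j. j < n \<Longrightarrow> 0 \<le> x j \<and> x j \<le> 1" and "\<And>j. j < n \<Longrightarrow> f x j = x j"
proof -
  define P where "P k x = (\<lambda>i. real (x i) / real (Suc k))" for k :: nat and x :: "nat \<Rightarrow> nat"
  \<comment> \<open>Where \<open>x i = Suc k\<close> the label has to be 1 even if the \<open>i\<close>-th coordinate is fixed.\<close>
  define label :: "nat \<Rightarrow> (nat \<Rightarrow> nat) \<Rightarrow> nat \<Rightarrow> nat" where
    "label k x i = (if x i \<noteq> Suc k \<and> P k x i \<le> f (P k x) i then 0 else 1)" for k x i
  have P01: "0 \<le> P k x i \<and> P k x i \<le> 1" if "x i \<le> Suc k" for k x i
  proof -
    have "real (x i) \<le> real (Suc k)" using that by (simp only: of_nat_le_iff)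
    then show ?thesis unfolding P_def by (simp add: divide_simps)
  qed
  have fP: "0 \<le> f (P k x) i \<and> f (P k x) i \<le> 1" if "\<forall>i<n. x i \<le> Suc k" "i < n" for k x i
    using that by (intro maps P01) auto
  have lab0: "P k x i \<le> f (P k x) i" if "label k x i = 0" for k x i
    using that by (auto simp: label_def split: if_splits)
  have lab1: "f (P k x) i \<le> P k x i" if "label k x i \<noteq> 0" "\<forall>i<n. x i \<le> Suc k" "i < n" for k x i
  proof (cases "x i = Suc k")
    case True
    then have "P k x i = 1" by (simp add: P_def)
    then show ?thesis using fP[OF that(2,3)] by simp
  next
    case False
    then show ?thesis using that(1) by (auto simp: label_def split: if_splits)
  qed
  have "\<exists>q. (\<forall>i<n. q i < Suc k) \<and> (\<forall>i<n. \<exists>r s. (\<forall>j<n. q j \<le> r j \<and> r j \<le> q j + 1) \<and>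
      (\<forall>j<n. q j \<le> s j \<and> s j \<le> q j + 1) \<and> label k r i = 0 \<and> label k s i \<noteq> 0)" for k
  proof -
    have "\<forall>x. (\<forall>i<n. x i \<le> Suc k) \<longrightarrow> (\<forall>i<n. label k x i = (0::nat) \<or> label k x i = 1)"
      by (simp add: label_def)
    moreover have "\<forall>x. (\<forall>i<n. x i \<le> Suc k) \<longrightarrow> (\<forall>i<n. x i = 0 \<longrightarrow> label k x i = 0)"
      using fP by (auto simp: label_def P_def)
    moreover have "\<forall>x. (\<forall>i<n. x i \<le> Suc k) \<longrightarrow> (\<forall>i<n. x i = Suc k \<longrightarrow> label k x i = 1)"
      by (simp add: label_def)
    ultimately obtain q where q1: "\<forall>i<n. q i < Suc k"
      and q2: "\<forall>i<n. \<exists>r s. (\<forall>j<n. q j \<le> r j \<and> r j \<le> q j + 1) \<and>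
         (\<forall>j<n. q j \<le> s j \<and> s j \<le> q j + 1) \<and> label k r i \<noteq> label k s i"
      by (rule kuhn_lemma[rotated, of n "Suc k" "label k"]) auto
    have signs: "\<exists>r s. Q r \<and> Q s \<and> label k r i = 0 \<and> label k s i \<noteq> 0"
      if differ: "\<exists>r s. Q r \<and> Q s \<and> label k r i \<noteq> label k s i" for Q i
    proof -
      obtain r s where rs: "Q r" "Q s" "label k r i \<noteq> label k s i" using differ by blast
      then have "label k r i = 0 \<and> label k s i \<noteq> 0 \<or> label k s i = 0 \<and> label k r i \<noteq> 0"
        by (auto simp: label_def split: if_splits)
      then show ?thesis using rs by blast
    qed
    have "\<forall>i<n. \<exists>r s. (\<forall>j<n. q j \<le> r j \<and> r j \<le> q j + 1) \<and>
        (\<forall>j<n. q j \<le> s j \<and> s j \<le> q j + 1) \<and> label k r i = 0 \<and> label k s i \<noteq> 0"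
      using q2 by (intro allI impI signs) blast
    with q1 show ?thesis by blast
  qed
  then obtain q where q: "\<And>k i. i < n \<Longrightarrow> q k i < Suc k"
    and ex: "\<And>k. \<forall>i<n. \<exists>r s. (\<forall>j<n. q k j \<le> r j \<and> r j \<le> q k j + 1) \<and>
      (\<forall>j<n. q k j \<le> s j \<and> s j \<le> q k j + 1) \<and> label k r i = 0 \<and> label k s i \<noteq> 0"
    by metis
  then have "\<forall>k i. \<exists>r s. i < n \<longrightarrow> (\<forall>j<n. q k j \<le> r j \<and> r j \<le> q k j + 1) \<and>
      (\<forall>j<n. q k j \<le> s j \<and> s j \<le> q k j + 1) \<and> label k r i = 0 \<and> label k s i \<noteq> 0"
    by blast
  then obtain r s where rs: "\<And>k i. i < n \<Longrightarrow> (\<forall>j<n. q k j \<le> r k i j \<and> r k i j \<le> q k j + 1) \<and>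
      (\<forall>j<n. q k j \<le> s k i j \<and> s k i j \<le> q k j + 1) \<and> label k (r k i) i = 0 \<and> label k (s k i) i \<noteq> 0"
    by metis
  have "\<And>k i. i < n \<Longrightarrow> 0 \<le> P k (q k) i \<and> P k (q k) i \<le> 1"
    using q by (intro P01) (simp add: less_imp_le)
  then obtain \<sigma> x where \<sigma>: "strict_mono (\<sigma> :: nat \<Rightarrow> nat)"
    and lim: "\<And>i. i < n \<Longrightarrow> (\<lambda>k. P (\<sigma> k) (q (\<sigma> k)) i) \<longlonglongrightarrow> x i"
    using unit_cube_convergent_subsequence[of n "\<lambda>k. P k (q k)"] by blast
  have near: "(\<lambda>k. P (\<sigma> k) (t (\<sigma> k)) j) \<longlonglongrightarrow> x j"
    if t: "\<And>k. q k j \<le> t k j \<and> t k j \<le> q k j + 1" and j: "j < n" for t j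
  proof -
    have "(\<lambda>k. P (\<sigma> k) (q (\<sigma> k)) j + 1 / real (Suc (\<sigma> k))) \<longlonglongrightarrow> x j + 0"
      using LIMSEQ_subseq_LIMSEQ[OF LIMSEQ_inverse_real_of_nat \<sigma>]
      by (intro tendsto_add lim j) (simp add: o_def inverse_eq_divide)
    moreover have "P k (q k) j \<le> P k (t k) j \<and> P k (t k) j \<le> P k (q k) j + 1 / real (Suc k)" for k
    proof -
      have "real (q k j) \<le> real (t k j)" "real (t k j) \<le> real (q k j) + 1"
        using t[of k] by linarith+
      then show ?thesis by (simp add: P_def divide_right_mono flip: add_divide_distrib)
    qed
    ultimately show ?thesis
      by (intro tendsto_sandwich[OF _ _ lim[OF j], of "\<lambda>k. P (\<sigma> k) (t (\<sigma> k)) j"]) auto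
  qed
  have cube: "t j \<le> Suc k" if "\<forall>j<n. q k j \<le> t j \<and> t j \<le> q k j + 1" "j < n" for t j k
    using that q[of j k] by fastforce
  have flim: "(\<lambda>k. f (P (\<sigma> k) (t (\<sigma> k))) i) \<longlonglongrightarrow> f x i"
    if "\<And>k. \<forall>j<n. q k j \<le> t k j \<and> t k j \<le> q k j + 1" "i < n" for t i
    using that near cube by (intro cont P01) blast+
  have "f x i = x i" if i: "i < n" for i
  proof (rule antisym)
    have "f (P k (s k i)) i \<le> P k (s k i) i" for k
      using rs[OF i, of k] cube i by (intro lab1) blast+
    then show "f x i \<le> x i"
      using rs[OF i] i by (intro tendsto_le[OF _ near[of _ "\<lambda>k. s k i"] flim[of "\<lambda>k. s k i"]]) auto
  next
    have "P k (r k i) i \<le> f (P k (r k i)) i" for k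
      using rs[OF i, of k] by (intro lab0) blast
    then show "x i \<le> f x i"
      using rs[OF i] i by (intro tendsto_le[OF _ flim[of "\<lambda>k. r k i"] near[of _ "\<lambda>k. r k i"]]) auto
  qed
  moreover have "0 \<le> x j \<and> x j \<le> 1" if "j < n" for j
    using LIMSEQ_le_const[OF lim[OF that], of 0] LIMSEQ_le_const2[OF lim[OF that], of 1]
      P01[of "q _" j] q[OF that] by (meson less_imp_le)
  ultimately show ?thesis by (rule that[rotated])
qed

text \<open>Schauder projection: with a finite \<open>\<epsilon>\<close>-net \<open>c i\<close> and the hat functions
\<open>\<phi> i y = max 0 (\<epsilon> - \<parallel>y - c i\<parallel>)\<close>, every \<open>y \<in> K\<close> is within \<open>\<epsilon>\<close> of the average of the \<open>c i\<close> with
weights proportional to \<open>\<phi> i y\<close>. Replacing \<open>f x\<close> by this average gives a self-map of the finite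
dimensional hull of the net, and it acts on the vectors \<open>l\<close> of weights.\<close>

lemma schauder_approximate:
  fixes f :: "'b::real_normed_vector \<Rightarrow> 'b"
  assumes K: "compact K" "convex K" "K \<noteq> {}" and f: "continuous_on K f" "f ` K \<subseteq> K" and e: "0 < \<epsilon>"
  shows "\<exists>x\<in>K. norm (f x - x) \<le> \<epsilon>"
proof -
  obtain N where N: "finite N" "N \<subseteq> K" "K \<subseteq> (\<Union>y\<in>N. ball y \<epsilon>)"
    using compactE_image[OF K(1), of K "\<lambda>y. ball y \<epsilon>"] e by (metis UN_I centre_in_ball open_ball subsetI)
  then have "N \<noteq> {}" using K(3) by auto
  define n where "n = card N"
  have n: "n > 0" using N \<open>N \<noteq> {}\<close> by (simp add: n_def card_gt_0_iff)
  obtain c where c: "bij_betw c {..<n} N"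
    using ex_bij_betw_nat_finite[OF N(1)] by (auto simp: n_def atLeast0LessThan)
  have cK: "c i \<in> K" if "i < n" for i using c N that by (auto simp: bij_betw_def)
  define \<phi> where "\<phi> i y = max 0 (\<epsilon> - norm (y - c i))" for i y
  define S where "S y = (\<Sum>i<n. \<phi> i y)" for y
  have \<phi>0: "0 \<le> \<phi> i y" for i y by (simp add: \<phi>_def)
  have Spos: "0 < S y" if y: "y \<in> K" for y
  proof -
    obtain z where z: "z \<in> N" "y \<in> ball z \<epsilon>" using N(3) y by blast
    obtain i where "i < n" "c i = z" using z(1) c by (auto simp: bij_betw_def)
    with z have "y \<in> ball (c i) \<epsilon>" by simp
    then have "0 < \<phi> i y" by (simp add: \<phi>_def dist_norm norm_minus_commute)
    then show ?thesis unfolding S_def using \<open>i < n\<close> \<phi>0 by (intro sum_pos2[of _ i]) auto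
  qed
  \<comment> \<open>The cube is mapped into \<open>K\<close> by a formula that is continuous also at \<open>l = 0\<close> and that for
    weights of sum 1, such as the values of \<open>g\<close> below, is the average with these weights.\<close>
  define T where "T l = (\<Sum>i<n. l i :: real)" for l
  define m where "m l = max 0 (1 - T l)" for l
  define w where "w l i = (l i + m l) / (T l + n * m l)" for l i
  define p where "p l = (\<Sum>i<n. w l i *\<^sub>R c i)" for l
  have den: "0 < T l + n * m l" if "\<And>j. j < n \<Longrightarrow> 0 \<le> l j \<and> l j \<le> (1::real)" for l
  proof (cases "T l > 0")
    case True
    then show ?thesis by (simp add: m_def add_pos_nonneg)
  next
    case False
    moreover have "0 \<le> T l" unfolding T_def using that by (intro sum_nonneg) auto
    ultimately show ?thesis using n by (simp add: m_def)
  qed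
  have pK: "p l \<in> K" if l: "\<And>j. j < n \<Longrightarrow> 0 \<le> l j \<and> l j \<le> 1" for l
    unfolding p_def
  proof (rule convex_sum[OF _ K(2)])
    have den_l: "0 < T l + n * m l" by (rule den) (rule l)
    then show "(\<Sum>i<n. w l i) = 1"
      by (simp add: w_def sum.distrib flip: sum_divide_distrib T_def)
    show "0 \<le> w l i" if "i \<in> {..<n}" for i
      using that den_l l[of i] unfolding w_def m_def by (intro divide_nonneg_pos add_nonneg_nonneg) auto
  qed (auto intro: cK)
  define g where "g l i = \<phi> i (f (p l)) / S (f (p l))" for l i
  have fpK: "f (p l) \<in> K" if l: "\<And>j. j < n \<Longrightarrow> 0 \<le> l j \<and> l j \<le> 1" for l
  proof -
    have "p l \<in> K" by (rule pK) (rule l)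
    then show ?thesis using f(2) by blast
  qed
  obtain l where l01: "\<And>j. j < n \<Longrightarrow> 0 \<le> l j \<and> l j \<le> 1" and fixed: "\<And>j. j < n \<Longrightarrow> g l j = l j"
  proof (rule brouwer_unit_cube[of n g])
    fix l i assume l: "\<And>j. j < n \<Longrightarrow> 0 \<le> l j \<and> l j \<le> (1::real)" and i: "i < n"
    have "\<phi> i y \<le> S y" for y
      unfolding S_def using i \<phi>0 by (intro member_le_sum) auto
    moreover have "0 < S (f (p l))" by (rule Spos, rule fpK) (rule l)
    ultimately show "0 \<le> g l i \<and> g l i \<le> 1"
      using \<phi>0 by (simp add: g_def divide_simps)
  next
    fix L l i assume L: "\<And>k j. j < n \<Longrightarrow> 0 \<le> L k j \<and> L k j \<le> (1::real)"
      and lim: "\<And>j. j < n \<Longrightarrow> (\<lambda>k. L k j) \<longlonglongrightarrow> l j" and i: "i < n"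
    have l: "0 \<le> l j \<and> l j \<le> 1" if "j < n" for j
      using LIMSEQ_le_const[OF lim[OF that], of 0] LIMSEQ_le_const2[OF lim[OF that], of 1] L[OF that] by blast
    have "(\<lambda>k. T (L k)) \<longlonglongrightarrow> T l" unfolding T_def by (intro tendsto_sum lim) auto
    moreover from this have "(\<lambda>k. m (L k)) \<longlonglongrightarrow> m l" unfolding m_def by (intro tendsto_intros)
    moreover have "T l + n * m l \<noteq> 0"
    proof -
      have "0 < T l + n * m l" by (rule den) (rule l)
      then show ?thesis by simp
    qed
    ultimately have "(\<lambda>k. w (L k) j) \<longlonglongrightarrow> w l j" if "j < n" for j
      unfolding w_def by (intro tendsto_intros lim that)
    then have "(\<lambda>k. p (L k)) \<longlonglongrightarrow> p l" unfolding p_def by (intro tendsto_intros) auto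
    then have fl: "(\<lambda>k. f (p (L k))) \<longlonglongrightarrow> f (p l)"
      by (intro continuous_on_tendsto_compose[OF f(1)] always_eventually allI pK) (auto simp: L l)
    then have \<phi>l: "(\<lambda>k. \<phi> j (f (p (L k)))) \<longlonglongrightarrow> \<phi> j (f (p l))" for j
      unfolding \<phi>_def by (intro tendsto_intros)
    moreover have "(\<lambda>k. S (f (p (L k)))) \<longlonglongrightarrow> S (f (p l))"
      unfolding S_def by (intro tendsto_intros \<phi>l)
    moreover have "0 < S (f (p l))" by (rule Spos, rule fpK) (rule l)
    ultimately show "(\<lambda>k. g (L k) i) \<longlonglongrightarrow> g l i"
      unfolding g_def by (intro tendsto_divide) auto
  qed blast
  define y where "y = f (p l)"
  have Sy: "S y > 0" unfolding y_def by (rule Spos, rule fpK) (rule l01)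
  have l_eq: "l i = \<phi> i y / S y" if "i < n" for i using fixed[OF that] by (simp add: g_def y_def)
  have "(\<Sum>i<n. l i) = (\<Sum>i<n. \<phi> i y / S y)" using l_eq by (intro sum.cong) auto
  also have "\<dots> = 1" using Sy by (simp flip: sum_divide_distrib S_def)
  finally have suml: "(\<Sum>i<n. l i) = 1" .
  then have pl: "p l = (\<Sum>i<n. l i *\<^sub>R c i)" by (simp add: p_def w_def m_def T_def)
  have "y - p l = (\<Sum>i<n. l i *\<^sub>R (y - c i))"
    by (simp add: pl scaleR_diff_right sum_subtractf suml flip: scaleR_sum_left)
  then have "norm (y - p l) \<le> (\<Sum>i<n. norm (l i *\<^sub>R (y - c i)))" by (simp only: norm_sum)
  also have "\<dots> \<le> (\<Sum>i<n. l i * \<epsilon>)"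
  proof (rule sum_mono)
    fix i assume "i \<in> {..<n}"
    then have i: "i < n" by simp
    show "norm (l i *\<^sub>R (y - c i)) \<le> l i * \<epsilon>"
    proof (cases "norm (y - c i) \<le> \<epsilon>")
      case True
      then show ?thesis using l01[OF i] by (simp add: mult_left_mono)
    next
      case False
      then show ?thesis using l_eq[OF i] by (simp add: \<phi>_def)
    qed
  qed
  also have "\<dots> = \<epsilon>" by (simp add: suml flip: sum_distrib_right)
  finally have "norm (f (p l) - p l) \<le> \<epsilon>" by (simp add: y_def)
  moreover have "p l \<in> K" by (rule pK) (rule l01)
  ultimately show ?thesis by blast
qed

theorem schauder_fixed_point:
  fixes f :: "'b::real_normed_vector \<Rightarrow> 'b"
  assumes K: "compact K" "convex K" "K \<noteq> {}" and f: "continuous_on K f" "f ` K \<subseteq> K"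
  obtains x where "x \<in> K" "f x = x"
proof -
  have "continuous_on K (\<lambda>x. norm (f x - x))" by (intro continuous_intros f)
  then obtain x where x: "x \<in> K" "\<And>y. y \<in> K \<Longrightarrow> norm (f x - x) \<le> norm (f y - y)"
    using continuous_attains_inf[OF K(1,3)] by blast
  have "norm (f x - x) \<le> 0 + \<epsilon>" if "\<epsilon> > 0" for \<epsilon>
    using schauder_approximate[OF K f that] x(2) by fastforce
  then have "norm (f x - x) \<le> 0" by (rule field_le_epsilon)
  then show ?thesis using x(1) that by simp
qed

section \<open>Pointwise function spaces with a semi-inner product\<close>

text \<open>With \<open>e = B(u, u)\<close> this yields the Cauchy--Schwarz inequality. With \<open>e\<close> a bound for the excess
of a quadratic functional at a point over its infimum, it yields that an almost minimizer almost
solves the Euler equation.\<close>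

lemma nonneg_quadratic_imp_le:
  fixes a b e :: real
  assumes "\<And>t. 0 \<le> e + 2 * t * a + t\<^sup>2 * b" and "0 \<le> b"
  shows "a\<^sup>2 \<le> e * b"
proof (cases "b = 0")
  case True
  show ?thesis
  proof (rule ccontr)
    assume "\<not> ?thesis"
    then have "a \<noteq> 0" using True by simp
    then show False using assms(1)[of "- (e + 1) / (2 * a)"] True by (simp add: field_simps)
  qed
next
  case False
  then have b: "b > 0" using assms(2) by simp
  have "0 \<le> b * (e + 2 * (- a / b) * a + (- a / b)\<^sup>2 * b)"
    using assms(1)[of "- a / b"] b by (intro mult_nonneg_nonneg) auto
  also have "\<dots> = e * b - a\<^sup>2" using b by (simp add: field_simps power2_eq_square)
  finally show ?thesis by simp
qed

text \<open>Elements of \<open>L\<^sup>2\<close> and of the form domain are functions, not classes, so the forms on them are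
degenerate and the spaces are subsets of a function type with pointwise operations. The locale is
used for \<open>L\<^sup>2\<close> and, on the form domain, for the energy, the \<open>L\<^sup>2\<close> product and their combination
\<open>E\<^sub>\<rho>\<close>.\<close>

locale semi_inner_space =
  fixes V :: "('a \<Rightarrow> real) set" and B :: "('a \<Rightarrow> real) \<Rightarrow> ('a \<Rightarrow> real) \<Rightarrow> real"
  assumes zero: "(\<lambda>x. 0) \<in> V"
    and add: "u \<in> V \<Longrightarrow> v \<in> V \<Longrightarrow> (\<lambda>x. u x + v x) \<in> V"
    and scale: "u \<in> V \<Longrightarrow> (\<lambda>x. r * u x) \<in> V"
    and sym: "u \<in> V \<Longrightarrow> v \<in> V \<Longrightarrow> B u v = B v u"
    and add_left: "u \<in> V \<Longrightarrow> v \<in> V \<Longrightarrow> w \<in> V \<Longrightarrow> B (\<lambda>x. u x + v x) w = B u w + B v w"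
    and scale_left: "u \<in> V \<Longrightarrow> w \<in> V \<Longrightarrow> B (\<lambda>x. r * u x) w = r * B u w"
    and nonneg: "u \<in> V \<Longrightarrow> 0 \<le> B u u"
begin

lemma diff: "u \<in> V \<Longrightarrow> v \<in> V \<Longrightarrow> (\<lambda>x. u x - v x) \<in> V"
  using add[OF _ scale[of v "- 1"], of u] by simp

lemma diff_left: "u \<in> V \<Longrightarrow> v \<in> V \<Longrightarrow> w \<in> V \<Longrightarrow> B (\<lambda>x. u x - v x) w = B u w - B v w"
  using add_left[OF _ scale[of v "- 1"], of u w] scale_left[of v w "- 1"] by simp

lemma add_right: "u \<in> V \<Longrightarrow> v \<in> V \<Longrightarrow> w \<in> V \<Longrightarrow> B w (\<lambda>x. u x + v x) = B w u + B w v"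
  using add_left[of u v w] by (simp add: sym add)

lemma scale_right: "u \<in> V \<Longrightarrow> w \<in> V \<Longrightarrow> B w (\<lambda>x. r * u x) = r * B w u"
  using scale_left[of u w r] by (simp add: sym scale)

lemma diff_right: "u \<in> V \<Longrightarrow> v \<in> V \<Longrightarrow> w \<in> V \<Longrightarrow> B w (\<lambda>x. u x - v x) = B w u - B w v"
  using diff_left[of u v w] by (simp add: sym diff)

lemmas bilinear = add diff scale add_left add_right diff_left diff_right scale_left scale_right

lemma add_scale_self:
  assumes "u \<in> V" "v \<in> V"
  shows "B (\<lambda>x. u x + t * v x) (\<lambda>x. u x + t * v x) = B u u + 2 * t * B u v + t\<^sup>2 * B v v"
  using assms sym[of v u]
  by (simp add: bilinear add_left[OF _ scale] add_right[OF _ scale] algebra_simps power2_eq_square)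

lemma cauchy_schwarz: "u \<in> V \<Longrightarrow> v \<in> V \<Longrightarrow> (B u v)\<^sup>2 \<le> B u u * B v v"
  by (rule nonneg_quadratic_imp_le) (auto simp: nonneg add scale simp flip: add_scale_self)

lemma abs_le_sqrt: "u \<in> V \<Longrightarrow> v \<in> V \<Longrightarrow> \<bar>B u v\<bar> \<le> sqrt (B u u) * sqrt (B v v)"
  using real_sqrt_le_mono[OF cauchy_schwarz, of u v] by (simp add: real_sqrt_mult)

lemma parallelogram:
  assumes "u \<in> V" "v \<in> V"
  shows "B (\<lambda>x. u x - v x) (\<lambda>x. u x - v x) + B (\<lambda>x. u x + v x) (\<lambda>x. u x + v x) = 2 * B u u + 2 * B v v"
  using assms by (simp add: bilinear)

lemma diff_self_le:
  assumes "u \<in> V" "v \<in> V" "w \<in> V"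
  shows "B (\<lambda>x. u x - v x) (\<lambda>x. u x - v x) \<le>
    2 * B (\<lambda>x. u x - w x) (\<lambda>x. u x - w x) + 2 * B (\<lambda>x. v x - w x) (\<lambda>x. v x - w x)"
  using parallelogram[of "\<lambda>x. u x - w x" "\<lambda>x. v x - w x"] assms
    nonneg[OF add[OF diff diff], of u w v w] by (simp add: diff)

lemma tendsto_left:
  assumes u: "\<And>n::nat. u n \<in> V" "v \<in> V" "w \<in> V"
    and lim: "(\<lambda>n. B (\<lambda>x. u n x - v x) (\<lambda>x. u n x - v x)) \<longlonglongrightarrow> 0"
  shows "(\<lambda>n. B (u n) w) \<longlonglongrightarrow> B v w"
proof (rule LIM_zero_cancel, rule Lim_null_comparison)
  show "(\<lambda>n. sqrt (B (\<lambda>x. u n x - v x) (\<lambda>x. u n x - v x)) * sqrt (B w w)) \<longlonglongrightarrow> 0"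
    using tendsto_mult[OF tendsto_real_sqrt[OF lim] tendsto_const, of "sqrt (B w w)"] by simp
  show "\<forall>\<^sub>F n in sequentially. norm (B (u n) w - B v w) \<le>
      sqrt (B (\<lambda>x. u n x - v x) (\<lambda>x. u n x - v x)) * sqrt (B w w)"
    using abs_le_sqrt[of "\<lambda>x. u _ x - v x" w] u by (simp add: bilinear)
qed

text \<open>A minimizing sequence of \<open>J u = B(u, u) - 2 l(u)\<close> is Cauchy by the parallelogram identity. The
limit represents \<open>l\<close> because \<open>B(u, w) - l(w)\<close> is small for almost minimizers \<open>u\<close>.\<close>

theorem riesz_representation:
  fixes l :: "('a \<Rightarrow> real) \<Rightarrow> real"
  assumes complete: "\<And>u. (\<And>n::nat. u n \<in> V) \<Longrightarrow>
        (\<And>\<epsilon>. \<epsilon> > 0 \<Longrightarrow> \<exists>k. \<forall>m\<ge>k. \<forall>n\<ge>k. B (\<lambda>x. u m x - u n x) (\<lambda>x. u m x - u n x) < \<epsilon>) \<Longrightarrow>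
        \<exists>v\<in>V. (\<lambda>n. B (\<lambda>x. u n x - v x) (\<lambda>x. u n x - v x)) \<longlonglongrightarrow> 0"
    and l_add: "\<And>u v. u \<in> V \<Longrightarrow> v \<in> V \<Longrightarrow> l (\<lambda>x. u x + v x) = l u + l v"
    and l_scale: "\<And>r u. u \<in> V \<Longrightarrow> l (\<lambda>x. r * u x) = r * l u"
    and l_bound: "\<And>v. v \<in> V \<Longrightarrow> \<bar>l v\<bar> \<le> C * sqrt (B v v)"
  shows "\<exists>u\<in>V. \<forall>v\<in>V. B u v = l v"
proof -
  define J where "J u = B u u - 2 * l u" for u
  have J_ge: "- C\<^sup>2 \<le> J u" if "u \<in> V" for u
    using l_bound[OF that] nonneg[OF that] sum_squares_bound[of C "sqrt (B u u)"]
    by (simp add: J_def)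
  then have bdd: "bdd_below (J ` V)" by (auto intro!: bdd_belowI)
  define d where "d = Inf (J ` V)"
  have d: "d \<le> J u" if "u \<in> V" for u unfolding d_def using that bdd by (intro cInf_lower) auto
  have "\<exists>u\<in>V. J u < d + 1 / real (Suc n)" for n
    using cInf_lessD[of "J ` V" "d + 1 / real (Suc n)"] zero by (auto simp: d_def)
  then obtain u where u: "\<And>n. u n \<in> V" "\<And>n. J (u n) < d + 1 / real (Suc n)" by metis
  have "B (\<lambda>x. u m x - u n x) (\<lambda>x. u m x - u n x) < 2 / real (Suc m) + 2 / real (Suc n)" for m n
  proof -
    define s where "s = (\<lambda>x. u m x + u n x)"
    have s: "s \<in> V" "l s = l (u m) + l (u n)" using u(1) by (simp_all add: s_def add l_add)
    have "4 * J (\<lambda>x. 1/2 * s x) = B s s - 4 * (l (u m) + l (u n))"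
      unfolding J_def
      by (simp only: scale_left[OF s(1) scale] scale_right[OF s(1)] l_scale[OF s(1)] s)
        (simp add: field_simps)
    then have "B (\<lambda>x. u m x - u n x) (\<lambda>x. u m x - u n x) =
        2 * J (u m) + 2 * J (u n) - 4 * J (\<lambda>x. 1/2 * s x)"
      using parallelogram[OF u(1) u(1), of m n] by (simp add: J_def s_def)
    then show ?thesis
      using u(2)[of m] u(2)[of n] d[OF scale[OF s(1)], of "1/2"] by simp
  qed
  note close = this
  have cauchy: "\<exists>k. \<forall>m\<ge>k. \<forall>n\<ge>k. B (\<lambda>x. u m x - u n x) (\<lambda>x. u m x - u n x) < \<epsilon>" if \<epsilon>: "\<epsilon> > 0" for \<epsilon>
  proof -
    obtain k where k: "1 / real (Suc k) < \<epsilon> / 4"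
      using reals_Archimedean[of "\<epsilon> / 4"] \<epsilon> by (auto simp: inverse_eq_divide)
    have k': "1 / real (Suc m) < \<epsilon> / 4" if "m \<ge> k" for m
      using k frac_le[of 1 1 "real (Suc k)" "real (Suc m)"] that by simp
    have "B (\<lambda>x. u m x - u n x) (\<lambda>x. u m x - u n x) < \<epsilon>" if "m \<ge> k" "n \<ge> k" for m n
      using close[of m n] k'[OF that(1)] k'[OF that(2)] by simp
    then show ?thesis by blast
  qed
  have "\<exists>v\<in>V. (\<lambda>n. B (\<lambda>x. u n x - v x) (\<lambda>x. u n x - v x)) \<longlonglongrightarrow> 0"
    by (rule complete) (fact u(1), fact cauchy)
  then obtain v where v: "v \<in> V" "(\<lambda>n. B (\<lambda>x. u n x - v x) (\<lambda>x. u n x - v x)) \<longlonglongrightarrow> 0"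
    by blast
  have "B v w = l w" if w: "w \<in> V" for w
  proof (rule LIMSEQ_unique)
    show "(\<lambda>n. B (u n) w) \<longlonglongrightarrow> B v w" using u(1) v w by (intro tendsto_left)
    have sq: "(B (u n) w - l w)\<^sup>2 \<le> 1 / real (Suc n) * B w w" for n
    proof (rule nonneg_quadratic_imp_le)
      fix t
      have "d \<le> J (\<lambda>x. u n x + t * w x)" using u(1) w by (intro d add scale)
      also have "\<dots> = J (u n) + 2 * t * (B (u n) w - l w) + t\<^sup>2 * B w w"
        using u(1) w by (simp add: J_def add_scale_self l_add l_scale scale algebra_simps)
      finally show "0 \<le> 1 / real (Suc n) + 2 * t * (B (u n) w - l w) + t\<^sup>2 * B w w"
        using u(2)[of n] by simp
    qed (rule nonneg[OF w])
    have "(\<lambda>n. 1 / real (Suc n) * B w w) \<longlonglongrightarrow> 0"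
      using tendsto_mult[OF LIMSEQ_inverse_real_of_nat tendsto_const, of "B w w"]
      by (simp add: inverse_eq_divide)
    then have "(\<lambda>n. (B (u n) w - l w)\<^sup>2) \<longlonglongrightarrow> 0"
      by (rule Lim_null_comparison[rotated]) (use sq in \<open>auto intro!: always_eventually\<close>)
    then show "(\<lambda>n. B (u n) w) \<longlonglongrightarrow> l w" by (simp add: LIM_zero_iff)
  qed
  then show ?thesis using v(1) by blast
qed

end

lemma L2_integrable_mult:
  assumes "f \<in> L2 M" "g \<in> L2 M"
  shows "integrable M (\<lambda>x. f x * g x)"
proof (rule Bochner_Integration.integrable_bound)
  show "integrable M (\<lambda>x. (f x)\<^sup>2 + (g x)\<^sup>2)" using assms by (simp add: L2_def)
  show "(\<lambda>x. f x * g x) \<in> borel_measurable M" using assms by (auto simp: L2_def)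
  show "AE x in M. norm (f x * g x) \<le> norm ((f x)\<^sup>2 + (g x)\<^sup>2)"
  proof (rule AE_I2)
    fix x
    have "2 * \<bar>f x\<bar> * \<bar>g x\<bar> \<le> (f x)\<^sup>2 + (g x)\<^sup>2"
      using sum_squares_bound[of "\<bar>f x\<bar>" "\<bar>g x\<bar>"] by simp
    moreover have "0 \<le> \<bar>f x\<bar> * \<bar>g x\<bar>" by simp
    ultimately have "\<bar>f x\<bar> * \<bar>g x\<bar> \<le> (f x)\<^sup>2 + (g x)\<^sup>2" by linarith
    then show "norm (f x * g x) \<le> norm ((f x)\<^sup>2 + (g x)\<^sup>2)"
      by (simp add: abs_mult)
  qed
qed

lemma semi_inner_space_L2: "semi_inner_space (L2 M) (L2_inner M)"
proof
  show "(\<lambda>x. u x + v x) \<in> L2 M" if "u \<in> L2 M" "v \<in> L2 M" for u v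
  proof -
    have "integrable M (\<lambda>x. (u x)\<^sup>2 + (v x)\<^sup>2 + 2 * (u x * v x))"
      using that L2_integrable_mult[OF that] by (simp add: L2_def)
    then show ?thesis using that by (auto simp: L2_def power2_sum mult.assoc)
  qed
  show "L2_inner M (\<lambda>x. u x + v x) w = L2_inner M u w + L2_inner M v w"
    if "u \<in> L2 M" "v \<in> L2 M" "w \<in> L2 M" for u v w
    using that by (simp add: L2_inner_def distrib_right L2_integrable_mult)
  show "L2_inner M (\<lambda>x. r * u x) w = r * L2_inner M u w" for r u w
    by (simp add: L2_inner_def mult.assoc)
  show "L2_inner M u v = L2_inner M v u" for u v
    by (simp add: L2_inner_def mult.commute)
  show "0 \<le> L2_inner M u u" for u
    by (simp add: L2_inner_def)
qed (auto simp: L2_def power_mult_distrib)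

lemma L2_norm_nonneg [simp]: "0 \<le> L2_norm M f"
  by (simp add: L2_norm_def L2_inner_def)

lemma L2_norm_square: "(L2_norm M f)\<^sup>2 = L2_inner M f f"
  by (simp add: L2_norm_def L2_inner_def)

section \<open>The shifted form and its resolvent\<close>

locale dirichlet_space =
  fixes M :: "'a measure" and F and E
  assumes form: "dirichlet_form M F E"
begin

lemma F_L2: "u \<in> F \<Longrightarrow> u \<in> L2 M"
  using form by (auto simp: dirichlet_form_def)

sublocale energy: semi_inner_space F E
  using form unfolding dirichlet_form_def by unfold_locales blast+

sublocale mass: semi_inner_space F "L2_inner M"
proof -
  interpret L: semi_inner_space "L2 M" "L2_inner M" by (rule semi_inner_space_L2)
  show "semi_inner_space F (L2_inner M)"
    by unfold_locales
      (auto intro: energy.zero energy.add energy.scale L.sym L.add_left L.scale_left L.nonneg F_L2)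
qed

lemma L2_inner_bound:
  "f \<in> L2 M \<Longrightarrow> g \<in> L2 M \<Longrightarrow> \<bar>L2_inner M f g\<bar> \<le> L2_norm M f * L2_norm M g"
  using semi_inner_space.abs_le_sqrt[OF semi_inner_space_L2] by (simp add: L2_norm_def)

definition shifted :: "real \<Rightarrow> ('a \<Rightarrow> real) \<Rightarrow> ('a \<Rightarrow> real) \<Rightarrow> real" where
  "shifted \<rho> u v = E u v + \<rho> * L2_inner M u v"

lemma semi_inner_space_shifted:
  assumes "0 \<le> \<rho>"
  shows "semi_inner_space F (shifted \<rho>)"
  using assms energy.nonneg mass.nonneg
  by unfold_locales
    (auto simp: shifted_def energy.bilinear mass.bilinear energy.zero energy.sym mass.sym algebra_simps)

lemma E1_eq: "E1 M E u = E u u + L2_inner M u u"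
  by (simp add: E1_def L2_norm_square)

lemma shifted_le_E1:
  assumes "u \<in> F"
  shows "shifted \<rho> u u \<le> max 1 \<rho> * E1 M E u"
proof -
  have "1 * E u u \<le> max 1 \<rho> * E u u" "\<rho> * L2_inner M u u \<le> max 1 \<rho> * L2_inner M u u"
    using energy.nonneg[OF assms] mass.nonneg[OF assms] by (intro mult_right_mono; simp)+
  then show ?thesis by (simp add: shifted_def E1_eq distrib_left)
qed

lemma E1_le_shifted:
  assumes "u \<in> F" "0 < \<rho>"
  shows "E1 M E u \<le> max 1 (1 / \<rho>) * shifted \<rho> u u"
proof -
  have "1 * E u u \<le> max 1 (1 / \<rho>) * E u u" "1 / \<rho> * (\<rho> * L2_inner M u u) \<le> max 1 (1 / \<rho>) * (\<rho> * L2_inner M u u)"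
    using energy.nonneg[OF assms(1)] mass.nonneg[OF assms(1)] assms(2) by (intro mult_right_mono; simp)+
  then show ?thesis using assms(2) by (simp add: shifted_def E1_eq distrib_left)
qed

text \<open>The norms of \<open>E\<^sub>\<rho>\<close> and \<open>E\<^sub>1\<close> are equivalent, so closedness of the form carries over.\<close>

lemma shifted_complete:
  assumes \<rho>: "0 < \<rho>" and u: "\<And>n::nat. u n \<in> F"
    and cauchy: "\<And>\<epsilon>. \<epsilon> > 0 \<Longrightarrow> \<exists>k. \<forall>m\<ge>k. \<forall>n\<ge>k. shifted \<rho> (\<lambda>x. u m x - u n x) (\<lambda>x. u m x - u n x) < \<epsilon>"
  shows "\<exists>v\<in>F. (\<lambda>n. shifted \<rho> (\<lambda>x. u n x - v x) (\<lambda>x. u n x - v x)) \<longlonglongrightarrow> 0"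
proof -
  interpret S: semi_inner_space F "shifted \<rho>" using \<rho> by (intro semi_inner_space_shifted) simp
  have closed: "(\<forall>n. u n \<in> F) \<and> (\<forall>\<epsilon>>0. \<exists>k::nat. \<forall>m\<ge>k. \<forall>n\<ge>k. E1 M E (\<lambda>x. u m x - u n x) < \<epsilon>) \<Longrightarrow>
      \<exists>v\<in>F. (\<lambda>n. E1 M E (\<lambda>x. u n x - v x)) \<longlonglongrightarrow> 0" for u
    using form unfolding dirichlet_form_def by blast
  have "\<exists>k. \<forall>m\<ge>k. \<forall>n\<ge>k. E1 M E (\<lambda>x. u m x - u n x) < \<epsilon>" if \<epsilon>: "\<epsilon> > 0" for \<epsilon>
  proof -
    define K where "K = max 1 (1 / \<rho>)"
    have K: "K > 0" by (simp add: K_def)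
    then obtain k where k: "\<And>m n. m \<ge> k \<Longrightarrow> n \<ge> k \<Longrightarrow>
        shifted \<rho> (\<lambda>x. u m x - u n x) (\<lambda>x. u m x - u n x) < \<epsilon> / K"
      using cauchy[of "\<epsilon> / K"] \<epsilon> by auto
    have "E1 M E (\<lambda>x. u m x - u n x) < \<epsilon>" if "m \<ge> k" "n \<ge> k" for m n
    proof -
      have "E1 M E (\<lambda>x. u m x - u n x) \<le> K * shifted \<rho> (\<lambda>x. u m x - u n x) (\<lambda>x. u m x - u n x)"
        unfolding K_def by (intro E1_le_shifted \<rho> S.diff u)
      also have "\<dots> < \<epsilon>" using k[OF that] K by (simp add: field_simps)
      finally show ?thesis .
    qed
    then show ?thesis by blast
  qed
  then obtain v where v: "v \<in> F" "(\<lambda>n. E1 M E (\<lambda>x. u n x - v x)) \<longlonglongrightarrow> 0"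
    using closed u by blast
  have "(\<lambda>n. shifted \<rho> (\<lambda>x. u n x - v x) (\<lambda>x. u n x - v x)) \<longlonglongrightarrow> 0"
  proof (rule tendsto_sandwich[OF _ _ tendsto_const])
    show "(\<lambda>n. max 1 \<rho> * E1 M E (\<lambda>x. u n x - v x)) \<longlonglongrightarrow> 0"
      using tendsto_mult[OF tendsto_const v(2), of "max 1 \<rho>"] by simp
  qed (auto intro!: always_eventually S.nonneg shifted_le_E1 S.diff u v)
  then show ?thesis using v(1) by blast
qed

lemma resolvent_exists:
  assumes \<rho>: "0 < \<rho>" and f: "f \<in> L2 M"
  shows "\<exists>u\<in>F. \<forall>v\<in>F. shifted \<rho> u v = L2_inner M f v"
proof -
  interpret S: semi_inner_space F "shifted \<rho>" using \<rho> by (intro semi_inner_space_shifted) simp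
  interpret L: semi_inner_space "L2 M" "L2_inner M" by (rule semi_inner_space_L2)
  show ?thesis
  proof (rule S.riesz_representation)
    fix v assume v: "v \<in> F"
    have "\<rho> * (L2_norm M v)\<^sup>2 \<le> shifted \<rho> v v"
      using energy.nonneg[OF v] by (simp add: shifted_def L2_norm_square)
    then have "L2_norm M v \<le> sqrt (shifted \<rho> v v / \<rho>)"
      using \<rho> by (intro real_le_rsqrt) (simp add: field_simps)
    then have "L2_norm M f * L2_norm M v \<le> L2_norm M f * sqrt (shifted \<rho> v v / \<rho>)"
      by (intro mult_left_mono) auto
    then show "\<bar>L2_inner M f v\<bar> \<le> L2_norm M f / sqrt \<rho> * sqrt (shifted \<rho> v v)"
      using L2_inner_bound[OF f F_L2[OF v]] by (simp add: real_sqrt_divide)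
  qed (auto intro: shifted_complete[OF \<rho>] L.add_right L.scale_right f F_L2)
qed

text \<open>With \<open>t = \<parallel>u\<parallel>\<close> the hypothesis is \<open>E(u, u) + \<rho> t\<^sup>2 \<le> C t\<close>, and \<open>C t - \<rho> t\<^sup>2\<close> is at most
\<open>C\<^sup>2 / (4 \<rho>)\<close>. The constant gets small for large \<open>\<rho>\<close>; this is where the size of \<open>\<rho>\<close> enters.\<close>

lemma
  assumes u: "u \<in> F" and \<rho>: "0 < \<rho>" and le: "shifted \<rho> u u \<le> C * L2_norm M u"
  shows energy_bound: "E u u \<le> C\<^sup>2 / (4 * \<rho>)"
    and L2_norm_bound: "0 \<le> C \<Longrightarrow> L2_norm M u \<le> C / \<rho>"
proof -
  define t where "t = L2_norm M u"
  have le': "E u u + \<rho> * t\<^sup>2 \<le> C * t" using le by (simp add: shifted_def t_def L2_norm_square)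
  have "0 \<le> (2 * \<rho> * t - C)\<^sup>2" by simp
  then have "4 * \<rho> * (C * t - \<rho> * t\<^sup>2) \<le> C\<^sup>2" by (simp add: power2_eq_square algebra_simps)
  then have "C * t - \<rho> * t\<^sup>2 \<le> C\<^sup>2 / (4 * \<rho>)" using \<rho> by (simp add: field_simps)
  then show "E u u \<le> C\<^sup>2 / (4 * \<rho>)" using le' by simp
  assume C: "0 \<le> C"
  have "t * (\<rho> * t) \<le> t * C" using le' energy.nonneg[OF u] by (simp add: power2_eq_square algebra_simps)
  then have "\<rho> * t \<le> C" if "t > 0" using that by simp
  moreover have "\<rho> * t \<le> C" if "t = 0" using that C by simp
  moreover have "0 \<le> t" by (simp add: t_def)
  ultimately have "\<rho> * t \<le> C" by linarith
  then show "L2_norm M u \<le> C / \<rho>" using \<rho> by (simp add: t_def field_simps)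
qed

end

section \<open>The fixed point problem for gradients\<close>

text \<open>The isometry property, derived in \<open>gradient_isometry\<close>, is the form in which the structure of the
space of tensors enters: it turns bounds on the energy into bounds on gradients.\<close>

locale isometric_gradient = dirichlet_space M F E for M :: "'a measure" and F E +
  fixes D :: "('a \<Rightarrow> real) \<Rightarrow> 'h::real_normed_vector"
  assumes D_add: "u \<in> F \<Longrightarrow> v \<in> F \<Longrightarrow> D (\<lambda>x. u x + v x) = D u + D v"
    and D_scale: "u \<in> F \<Longrightarrow> D (\<lambda>x. r * u x) = r *\<^sub>R D u"
    and norm_D: "u \<in> F \<Longrightarrow> (norm (D u))\<^sup>2 = E u u"
    and embedding: "compactly_embedded M F E"
begin

lemma D_diff: "u \<in> F \<Longrightarrow> v \<in> F \<Longrightarrow> D (\<lambda>x. u x - v x) = D u - D v"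
  using D_add[OF _ energy.scale[of v "- 1"], of u] D_scale[of v "- 1"] by simp

lemma D_tendsto:
  assumes "\<And>n::nat. u n \<in> F" "v \<in> F" "(\<lambda>n. E (\<lambda>x. u n x - v x) (\<lambda>x. u n x - v x)) \<longlonglongrightarrow> 0"
  shows "(\<lambda>n. D (u n)) \<longlonglongrightarrow> D v"
proof -
  have "(\<lambda>n. (norm (D (u n) - D v))\<^sup>2) \<longlonglongrightarrow> 0"
    using assms(3) norm_D[OF energy.diff[OF assms(1,2)]] by (simp add: D_diff assms(1,2))
  then have "(\<lambda>n. norm (D (u n) - D v)) \<longlonglongrightarrow> 0" by simp
  then show ?thesis by (simp only: tendsto_norm_zero_iff LIM_zero_iff)
qed

text \<open>For \<open>\<rho> > 0\<close> this is the image under the resolvent of the closed ball of radius \<open>C\<close> in \<open>L\<^sup>2\<close>. The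
description by test functions makes it evident that the set is closed under limits, without weak
compactness of the ball.\<close>

definition resolvent_ball :: "real \<Rightarrow> real \<Rightarrow> ('a \<Rightarrow> real) set" where
  "resolvent_ball \<rho> C = {u \<in> F. \<forall>v\<in>F. \<bar>shifted \<rho> u v\<bar> \<le> C * L2_norm M v}"

lemma resolvent_ball_energy_bound:
  assumes "0 < \<rho>" "u \<in> resolvent_ball \<rho> C"
  shows "(norm (D u))\<^sup>2 \<le> C\<^sup>2 / (4 * \<rho>)"
proof -
  have u: "u \<in> F" and "\<bar>shifted \<rho> u u\<bar> \<le> C * L2_norm M u"
    using assms(2) unfolding resolvent_ball_def by blast+
  then have "shifted \<rho> u u \<le> C * L2_norm M u" by simp
  then show ?thesis using energy_bound[OF u assms(1)] by (simp add: norm_D u)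
qed

lemma convex_resolvent_ball:
  assumes "0 < \<rho>"
  shows "convex (D ` resolvent_ball \<rho> C)"
proof (rule convexI)
  interpret S: semi_inner_space F "shifted \<rho>" using assms by (intro semi_inner_space_shifted) simp
  fix x y and s t :: real
  assume xy: "x \<in> D ` resolvent_ball \<rho> C" "y \<in> D ` resolvent_ball \<rho> C" and st: "0 \<le> s" "0 \<le> t" "s + t = 1"
  obtain u v where u: "x = D u" "u \<in> F" "\<And>w. w \<in> F \<Longrightarrow> \<bar>shifted \<rho> u w\<bar> \<le> C * L2_norm M w"
    and v: "y = D v" "v \<in> F" "\<And>w. w \<in> F \<Longrightarrow> \<bar>shifted \<rho> v w\<bar> \<le> C * L2_norm M w"
    using xy by (auto simp: resolvent_ball_def)
  have "\<bar>shifted \<rho> (\<lambda>x. s * u x + t * v x) w\<bar> \<le> C * L2_norm M w" if w: "w \<in> F" for w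
  proof -
    have "\<bar>s * shifted \<rho> u w + t * shifted \<rho> v w\<bar> \<le> s * \<bar>shifted \<rho> u w\<bar> + t * \<bar>shifted \<rho> v w\<bar>"
      using st by (intro order_trans[OF abs_triangle_ineq]) (simp add: abs_mult)
    also have "\<dots> \<le> s * (C * L2_norm M w) + t * (C * L2_norm M w)"
      using st u(3)[OF w] v(3)[OF w] by (intro add_mono mult_left_mono)
    also have "\<dots> = C * L2_norm M w" using st(3) by (simp flip: distrib_right)
    finally show ?thesis using u(2) v(2) w by (simp add: S.add_left S.scale_left S.scale)
  qed
  then have mem: "(\<lambda>x. s * u x + t * v x) \<in> resolvent_ball \<rho> C"
    using u(2) v(2) by (simp add: resolvent_ball_def S.add S.scale)
  have eq: "D (\<lambda>x. s * u x + t * v x) = s *\<^sub>R x + t *\<^sub>R y"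
    unfolding u(1) v(1)
    by (simp only: D_add[OF energy.scale energy.scale] D_scale u(2) v(2))
  show "s *\<^sub>R x + t *\<^sub>R y \<in> D ` resolvent_ball \<rho> C"
    unfolding eq[symmetric] by (rule imageI[OF mem])
qed

text \<open>An \<open>L\<^sup>2\<close> convergent subsequence converges in the form norm as well: testing the two defining
inequalities with \<open>u\<^sub>m - u\<^sub>n\<close> bounds \<open>E\<^sub>\<rho>(u\<^sub>m - u\<^sub>n, u\<^sub>m - u\<^sub>n)\<close> by \<open>2 C \<parallel>u\<^sub>m - u\<^sub>n\<parallel>\<close>.\<close>

lemma compact_resolvent_ball:
  assumes \<rho>: "0 < \<rho>" and C: "0 \<le> C"
  shows "compact (D ` resolvent_ball \<rho> C)"
  unfolding compact_eq_seq_compact_metric seq_compact_def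
proof (intro allI impI)
  interpret S: semi_inner_space F "shifted \<rho>" using \<rho> by (intro semi_inner_space_shifted) simp
  interpret L: semi_inner_space "L2 M" "L2_inner M" by (rule semi_inner_space_L2)
  fix w :: "nat \<Rightarrow> 'h" assume "\<forall>n. w n \<in> D ` resolvent_ball \<rho> C"
  then obtain u where w: "\<And>n. w n = D (u n)" and uS: "\<And>n. u n \<in> resolvent_ball \<rho> C"
    by (simp add: image_iff) metis
  have u: "u n \<in> F" and bound: "v \<in> F \<Longrightarrow> \<bar>shifted \<rho> (u n) v\<bar> \<le> C * L2_norm M v" for n v
    using uS[of n] by (auto simp: resolvent_ball_def)
  have "E1 M E (u n) \<le> C\<^sup>2 / (4 * \<rho>) + (C / \<rho>)\<^sup>2" for n
    unfolding E1_def using bound[OF u, of n n] C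
    by (intro add_mono energy_bound power_mono L2_norm_bound u \<rho>) auto
  then have "(\<forall>n. u n \<in> F) \<and> (\<exists>K. \<forall>n. E1 M E (u n) \<le> K)" using u by blast
  then obtain f r where f: "f \<in> L2 M" and r: "strict_mono (r :: nat \<Rightarrow> nat)"
    and lim: "(\<lambda>n. L2_norm M (\<lambda>x. u (r n) x - f x)) \<longlonglongrightarrow> 0"
    using embedding unfolding compactly_embedded_def by blast
  define d where "d m n = L2_norm M (\<lambda>x. u (r m) x - u (r n) x)" for m n
  define p where "p n = (L2_norm M (\<lambda>x. u (r n) x - f x))\<^sup>2" for n
  have p: "p \<longlonglongrightarrow> 0" using tendsto_power[OF lim, of 2] by (simp add: p_def[abs_def])
  have d: "(d m n)\<^sup>2 \<le> 2 * p m + 2 * p n" for m n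
    unfolding d_def p_def L2_norm_square by (intro L.diff_self_le F_L2 u f)
  have S_le: "shifted \<rho> (\<lambda>x. u (r m) x - u (r n) x) (\<lambda>x. u (r m) x - u (r n) x) \<le> 2 * C * d m n" for m n
  proof -
    have diff: "(\<lambda>x. u (r m) x - u (r n) x) \<in> F" by (intro S.diff u)
    show ?thesis
      using bound[OF diff, of "r m"] bound[OF diff, of "r n"] S.diff_left[OF u u diff, of "r m" "r n"]
      by (simp add: d_def)
  qed
  have "\<exists>k. \<forall>m\<ge>k. \<forall>n\<ge>k. shifted \<rho> (\<lambda>x. u (r m) x - u (r n) x) (\<lambda>x. u (r m) x - u (r n) x) < \<epsilon>"
    if \<epsilon>: "\<epsilon> > 0" for \<epsilon>
  proof -
    define \<delta> where "\<delta> = \<epsilon> / (2 * C + 1)"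
    have \<delta>: "\<delta> > 0" using \<epsilon> C by (simp add: \<delta>_def)
    then obtain k where k: "\<And>n. n \<ge> k \<Longrightarrow> p n < \<delta>\<^sup>2 / 4"
      using order_tendstoD(2)[OF p, of "\<delta>\<^sup>2 / 4"] by (auto simp: eventually_sequentially)
    have "shifted \<rho> (\<lambda>x. u (r m) x - u (r n) x) (\<lambda>x. u (r m) x - u (r n) x) < \<epsilon>" if "m \<ge> k" "n \<ge> k" for m n
    proof -
      have "(d m n)\<^sup>2 < \<delta>\<^sup>2" using d[of m n] k[OF that(1)] k[OF that(2)] by linarith
      then have "d m n < \<delta>" using \<delta> by (intro power_less_imp_less_base[of "d m n" 2]) auto
      then have "2 * C * d m n \<le> 2 * C * \<delta>" using C by (intro mult_left_mono) auto
      also have "\<dots> < (2 * C + 1) * \<delta>" using \<delta> by (simp add: distrib_right)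
      also have "\<dots> = \<epsilon>" using C by (simp add: \<delta>_def)
      finally show ?thesis using S_le[of m n] by linarith
    qed
    then show ?thesis by blast
  qed
  then obtain v where v: "v \<in> F"
    and uv: "(\<lambda>n. shifted \<rho> (\<lambda>x. u (r n) x - v x) (\<lambda>x. u (r n) x - v x)) \<longlonglongrightarrow> 0"
    using shifted_complete[OF \<rho>, of "\<lambda>n. u (r n)", OF u] by blast
  have "\<bar>shifted \<rho> v z\<bar> \<le> C * L2_norm M z" if "z \<in> F" for z
    using S.tendsto_left[OF u v that uv] bound[OF that]
    by (intro LIMSEQ_le_const2[OF tendsto_rabs]) auto
  then have "v \<in> resolvent_ball \<rho> C" using v by (simp add: resolvent_ball_def)
  moreover have "(\<lambda>n. D (u (r n))) \<longlonglongrightarrow> D v"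
  proof (intro D_tendsto u v tendsto_sandwich[OF _ _ tendsto_const uv] always_eventually allI)
    fix n
    have "(\<lambda>x. u (r n) x - v x) \<in> F" by (intro S.diff u v)
    then show "0 \<le> E (\<lambda>x. u (r n) x - v x) (\<lambda>x. u (r n) x - v x)"
      "E (\<lambda>x. u (r n) x - v x) (\<lambda>x. u (r n) x - v x) \<le> shifted \<rho> (\<lambda>x. u (r n) x - v x) (\<lambda>x. u (r n) x - v x)"
      using \<rho> energy.nonneg mass.nonneg by (simp_all add: shifted_def)
  qed
  ultimately show "\<exists>l\<in>D ` resolvent_ball \<rho> C. \<exists>r. strict_mono r \<and> (w \<circ> r) \<longlonglongrightarrow> l"
    using r by (auto simp: w o_def)
qed

text \<open>Schauder's theorem is applied to \<open>w \<mapsto> D (R w)\<close> on the gradients of the resolvent ball of radius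
\<open>2 c\<close>. This radius is \<open>c (1 + 1)\<close>, the bound for \<open>b\<close> on the unit ball, and the condition on \<open>\<rho>\<close>
keeps the gradients inside the unit ball.\<close>

theorem weak_solution_exists:
  fixes b :: "'h \<Rightarrow> 'a \<Rightarrow> real"
  assumes b_L2: "\<And>v. b v \<in> L2 M"
    and b_continuous: "L2_continuous_on M (D ` F) b"
    and c: "0 < c"
    and growth: "\<And>v. v \<in> D ` F \<Longrightarrow> L2_norm M (b v) \<le> c * (1 + norm v)"
    and \<rho>: "c\<^sup>2 \<le> \<rho>"
  shows "\<exists>u. weak_solution M F E D b \<rho> u"
proof -
  have \<rho>0: "0 < \<rho>" using c \<rho> by (smt (verit) zero_less_power)
  interpret S: semi_inner_space F "shifted \<rho>" using \<rho>0 by (intro semi_inner_space_shifted) simp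
  interpret L: semi_inner_space "L2 M" "L2_inner M" by (rule semi_inner_space_L2)
  define K where "K = D ` resolvent_ball \<rho> (2 * c)"
  have KF: "K \<subseteq> D ` F" by (auto simp: K_def resolvent_ball_def)
  have b_le: "L2_norm M (b w) \<le> 2 * c" if w: "w \<in> K" for w
  proof -
    obtain u where u: "w = D u" "u \<in> resolvent_ball \<rho> (2 * c)" using w by (auto simp: K_def)
    have "(norm w)\<^sup>2 \<le> (2 * c)\<^sup>2 / (4 * \<rho>)" unfolding u(1) by (rule resolvent_ball_energy_bound[OF \<rho>0 u(2)])
    also have "\<dots> \<le> 1" using \<rho> \<rho>0 by (simp add: power_mult_distrib)
    finally have "norm w \<le> 1" by (simp add: power_le_one_iff abs_square_le_1)
    then have "c * (1 + norm w) \<le> c * 2" using c by (intro mult_left_mono) auto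
    then show ?thesis using growth[of w] w KF by fastforce
  qed
  have "\<forall>w. \<exists>u\<in>F. \<forall>v\<in>F. shifted \<rho> u v = L2_inner M (\<lambda>x. - 1 * b w x) v"
    by (intro allI resolvent_exists \<rho>0 L.scale b_L2)
  then obtain R where R: "\<And>w. R w \<in> F"
    and R_eq: "\<And>w v. v \<in> F \<Longrightarrow> shifted \<rho> (R w) v = - L2_inner M (b w) v"
    using L.scale_left[OF b_L2 F_L2, of _ "- 1"] by (metis mult_minus1)
  have RK: "D (R w) \<in> K" if w: "w \<in> K" for w
  proof -
    have "\<bar>shifted \<rho> (R w) v\<bar> \<le> 2 * c * L2_norm M v" if v: "v \<in> F" for v
    proof -
      have "\<bar>shifted \<rho> (R w) v\<bar> \<le> L2_norm M (b w) * L2_norm M v"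
        using L2_inner_bound[OF b_L2 F_L2[OF v]] by (simp add: R_eq v)
      also have "\<dots> \<le> 2 * c * L2_norm M v" by (intro mult_right_mono b_le w) simp
      finally show ?thesis .
    qed
    then show ?thesis unfolding K_def resolvent_ball_def using R by blast
  qed
  have continuous: "continuous_on K (\<lambda>w. D (R w))"
    unfolding continuous_on_sequentially comp_def
  proof (intro allI ballI impI, elim conjE)
    fix w z assume z: "z \<in> K" and w: "\<forall>n::nat. w n \<in> K" "w \<longlonglongrightarrow> z"
    define \<beta> where "\<beta> n = L2_norm M (\<lambda>x. b (w n) x - b z x)" for n
    have \<beta>: "\<beta> \<longlonglongrightarrow> 0"
      unfolding \<beta>_def using b_continuous w z KF unfolding L2_continuous_on_def by blast
    have le: "E (\<lambda>x. R (w n) x - R z x) (\<lambda>x. R (w n) x - R z x) \<le> (\<beta> n)\<^sup>2 / (4 * \<rho>)" for n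
    proof (rule energy_bound[OF _ \<rho>0])
      let ?u = "\<lambda>x. R (w n) x - R z x"
      show u: "?u \<in> F" by (intro S.diff R)
      have "shifted \<rho> ?u ?u = - L2_inner M (\<lambda>x. b (w n) x - b z x) ?u"
        by (subst S.diff_left[OF R R u]) (simp add: R_eq u L.diff_left[OF b_L2 b_L2 F_L2[OF u]])
      then show "shifted \<rho> ?u ?u \<le> \<beta> n * L2_norm M ?u"
        using L2_inner_bound[OF L.diff[OF b_L2 b_L2] F_L2[OF u], of "w n" z] by (simp add: \<beta>_def)
    qed
    have "(\<lambda>n. (\<beta> n)\<^sup>2 / (4 * \<rho>)) \<longlonglongrightarrow> 0"
      using tendsto_divide[OF tendsto_power[OF \<beta>, of 2] tendsto_const, of "4 * \<rho>"] \<rho>0 by simp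
    then have "(\<lambda>n. E (\<lambda>x. R (w n) x - R z x) (\<lambda>x. R (w n) x - R z x)) \<longlonglongrightarrow> 0"
      by (rule tendsto_sandwich[OF _ _ tendsto_const, rotated 2])
        (auto intro!: always_eventually le energy.nonneg energy.diff R)
    then show "(\<lambda>n. D (R (w n))) \<longlonglongrightarrow> D (R z)" by (rule D_tendsto[OF R R])
  qed
  have nonempty: "K \<noteq> {}"
  proof -
    have "shifted \<rho> (\<lambda>x. 0) v = 0" if "v \<in> F" for v
      using S.scale_left[OF S.zero that, of 0] by simp
    then have "(\<lambda>x. 0) \<in> resolvent_ball \<rho> (2 * c)"
      using c by (simp add: resolvent_ball_def S.zero)
    then show ?thesis by (auto simp: K_def)
  qed
  obtain w where w: "w \<in> K" "D (R w) = w"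
  proof (rule schauder_fixed_point[OF _ _ nonempty continuous])
    show "compact K" unfolding K_def using c by (intro compact_resolvent_ball \<rho>0) simp
    show "convex K" unfolding K_def by (rule convex_resolvent_ball[OF \<rho>0])
  qed (use RK in auto)
  have "weak_solution M F E D b \<rho> (R w)"
    unfolding weak_solution_def
  proof (intro conjI ballI R)
    fix v assume "v \<in> F"
    then show "E (R w) v + L2_inner M (b (D (R w))) v + \<rho> * L2_inner M (R w) v = 0"
      using R_eq[of v w] unfolding w(2) shifted_def by linarith
  qed
  then show ?thesis by blast
qed

end

section \<open>The gradient is isometric\<close>

lemma core_diff:
  assumes form: "dirichlet_form M F E" and "g \<in> core F" "h \<in> core F"
  shows "(\<lambda>x. g x - h x) \<in> core F"
proof -
  interpret dirichlet_space M F E by unfold_locales (rule form)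
  have gh: "g \<in> F" "h \<in> F" "continuous_on UNIV g" "continuous_on UNIV h"
    "compact (closure {x. g x \<noteq> 0})" "compact (closure {x. h x \<noteq> 0})"
    using assms(2,3) by (auto simp: core_def cont_cpt_supp_def)
  have "closure {x. g x - h x \<noteq> 0} \<subseteq> closure ({x. g x \<noteq> 0} \<union> {x. h x \<noteq> 0})"
    by (rule closure_mono) auto
  then have "closure {x. g x - h x \<noteq> 0} =
      (closure {x. g x \<noteq> 0} \<union> closure {x. h x \<noteq> 0}) \<inter> closure {x. g x - h x \<noteq> 0}"
    by (auto simp: closure_Un)
  also have "compact \<dots>" using gh by (intro compact_Int_closed compact_Un) auto
  finally show ?thesis
    using gh energy.diff by (auto simp: core_def cont_cpt_supp_def intro: continuous_intros)
qed

text \<open>On the core, \<open>\<parallel>D g\<parallel>\<^sup>2\<close> is the total mass of the energy measure of \<open>g\<close>, which is \<open>E(g, g)\<close>.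
Regularity gives core functions \<open>g\<^sub>n\<close> that converge to \<open>u\<close> in the form norm. Their gradients form
a Cauchy sequence, and since \<open>D\<close> is closed the limit is \<open>D u\<close>.\<close>

lemma gradient_isometry:
  fixes D :: "('a::topological_space \<Rightarrow> real) \<Rightarrow> 'h::{real_inner, complete_space}"
  assumes form: "dirichlet_form M F E"
    and regular: "regular_form M F E"
    and measures: "energy_measures F E \<Gamma>"
    and mass: "\<And>g h. g \<in> core F \<Longrightarrow> h \<in> core F \<Longrightarrow> \<Gamma> g h UNIV = E g h"
    and H: "is_H_completion F \<Gamma> tensor"
    and gradient: "is_gradient M F tensor D"
    and u: "u \<in> F"
  shows "(norm (D u))\<^sup>2 = E u u"
proof -
  interpret dirichlet_space M F E by unfold_locales (rule form)
  have one: "(\<lambda>x. 1) \<in> bounded_borel" by (auto simp: bounded_borel_def)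
  have core: "(norm (D g))\<^sup>2 = E g g" if g: "g \<in> core F" for g
  proof -
    have "(norm (D g))\<^sup>2 = inner (tensor g (\<lambda>x. 1)) (tensor g (\<lambda>x. 1))"
      using gradient g by (simp add: is_gradient_def power2_norm_eq_inner)
    also have "\<dots> = signed_integral (\<Gamma> g g) (\<lambda>x. 1 * 1)"
      using H g one unfolding is_H_completion_def by blast
    also have "\<dots> = \<Gamma> g g UNIV"
    proof -
      obtain P N where PN: "difference_of (\<Gamma> g g) P N"
        using measures g unfolding energy_measures_def signed_radon_measure_def by blast
      then have "space P = UNIV" "space N = UNIV"
        by (auto simp: difference_of_def radon_measure_def dest!: sets_eq_imp_space_eq)
      then show ?thesis
        using signed_integral_eq[OF PN one] PN by (simp add: difference_of_def)
    qed
    finally show ?thesis by (simp add: mass g)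
  qed
  have "\<exists>g\<in>core F. E1 M E (\<lambda>x. u x - g x) < inverse (real (Suc n))" for n
    using regular u unfolding regular_form_def by simp
  then obtain g where g: "\<And>n. g n \<in> core F"
    and gE1: "\<And>n. E1 M E (\<lambda>x. u x - g n x) < inverse (real (Suc n))" by metis
  have gF: "g n \<in> F" for n using g[of n] by (simp add: core_def)
  have sym: "B (\<lambda>x. g n x - u x) (\<lambda>x. g n x - u x) = B (\<lambda>x. u x - g n x) (\<lambda>x. u x - g n x)"
    if "semi_inner_space F B" for B n
    using semi_inner_space.scale_left[OF that, of "\<lambda>x. u x - g n x" "\<lambda>x. - 1 * (u x - g n x)" "- 1"]
      semi_inner_space.scale_right[OF that, of "\<lambda>x. u x - g n x" "\<lambda>x. u x - g n x" "- 1"]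
      semi_inner_space.scale[OF that, of "\<lambda>x. u x - g n x" "- 1"] energy.diff[OF u gF] by simp
  have Eg: "0 \<le> E (\<lambda>x. g n x - u x) (\<lambda>x. g n x - u x)"
      "E (\<lambda>x. g n x - u x) (\<lambda>x. g n x - u x) \<le> inverse (real (Suc n))"
      "0 \<le> L2_inner M (\<lambda>x. g n x - u x) (\<lambda>x. g n x - u x)"
      "L2_inner M (\<lambda>x. g n x - u x) (\<lambda>x. g n x - u x) \<le> inverse (real (Suc n))" for n
    using gE1[of n] energy.nonneg[OF energy.diff[OF u gF[of n]]] mass.nonneg[OF energy.diff[OF u gF[of n]]]
      sym[OF energy.semi_inner_space_axioms, of n] sym[OF mass.semi_inner_space_axioms, of n]
    unfolding E1_eq by linarith+
  have E_lim: "(\<lambda>n. E (\<lambda>x. g n x - u x) (\<lambda>x. g n x - u x)) \<longlonglongrightarrow> 0"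
    by (rule tendsto_sandwich[OF _ _ tendsto_const LIMSEQ_inverse_real_of_nat]) (use Eg in auto)
  have "(\<lambda>n. L2_inner M (\<lambda>x. g n x - u x) (\<lambda>x. g n x - u x)) \<longlonglongrightarrow> 0"
    by (rule tendsto_sandwich[OF _ _ tendsto_const LIMSEQ_inverse_real_of_nat]) (use Eg in auto)
  then have L_lim: "(\<lambda>n. L2_norm M (\<lambda>x. g n x - u x)) \<longlonglongrightarrow> 0"
    using tendsto_real_sqrt[of _ 0] by (simp add: L2_norm_def)
  have D_diff: "D (\<lambda>x. v x - w x) = D v - D w" if "v \<in> F" "w \<in> F" for v w
  proof -
    have "D (\<lambda>x. v x + - 1 * w x) = D v + (- 1) *\<^sub>R D w"
      using gradient that energy.scale[OF that(2), of "- 1"] unfolding is_gradient_def by metis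
    then show ?thesis by simp
  qed
  have "Cauchy (\<lambda>n. D (g n))"
  proof (rule metric_CauchyI)
    fix \<epsilon> :: real assume \<epsilon>: "\<epsilon> > 0"
    then obtain k where k: "\<And>n. n \<ge> k \<Longrightarrow> E (\<lambda>x. g n x - u x) (\<lambda>x. g n x - u x) < \<epsilon>\<^sup>2 / 4"
      using order_tendstoD(2)[OF E_lim, of "\<epsilon>\<^sup>2 / 4"] by (auto simp: eventually_sequentially)
    have "dist (D (g m)) (D (g n)) < \<epsilon>" if "m \<ge> k" "n \<ge> k" for m n
    proof -
      have "(norm (D (g m) - D (g n)))\<^sup>2 = E (\<lambda>x. g m x - g n x) (\<lambda>x. g m x - g n x)"
        using core[OF core_diff[OF form g g]] by (simp add: D_diff gF)
      also have "\<dots> < \<epsilon>\<^sup>2"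
        using energy.diff_self_le[OF gF gF u, of m n] k[OF that(1)] k[OF that(2)] by linarith
      finally have "norm (D (g m) - D (g n)) < \<epsilon>" using \<epsilon> by (simp add: power2_less_imp_less)
      then show ?thesis by (simp add: dist_norm)
    qed
    then show "\<exists>k. \<forall>m\<ge>k. \<forall>n\<ge>k. dist (D (g m)) (D (g n)) < \<epsilon>" by blast
  qed
  then obtain h where h: "(\<lambda>n. D (g n)) \<longlonglongrightarrow> h" using Cauchy_convergent convergent_def by blast
  have closed: "f \<in> L2 M \<Longrightarrow> (\<forall>n::nat. v n \<in> F) \<and> (\<lambda>n. L2_norm M (\<lambda>x. v n x - f x)) \<longlonglongrightarrow> 0 \<and>
      (\<lambda>n. D (v n)) \<longlonglongrightarrow> h \<Longrightarrow> D f = h" for f v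
    using gradient unfolding is_gradient_def by blast
  have "D u = h" by (rule closed[OF F_L2[OF u], of g]) (use gF L_lim h in blast)
  with h have "(\<lambda>n. (norm (D (g n)))\<^sup>2) \<longlonglongrightarrow> (norm (D u))\<^sup>2" by (intro tendsto_intros) simp
  moreover have "(\<lambda>n. E (\<lambda>x. g n x - u x) (\<lambda>x. g n x - u x) + 2 * E (g n) u - E u u) \<longlonglongrightarrow> 0 + 2 * E u u - E u u"
    by (intro tendsto_intros E_lim energy.tendsto_left gF u)
  then have "(\<lambda>n. (norm (D (g n)))\<^sup>2) \<longlonglongrightarrow> E u u"
    using gF u energy.sym[OF u gF] by (simp add: core g energy.bilinear)
  ultimately show ?thesis by (rule LIMSEQ_unique)
qed

section \<open>Existence of weak solutions\<close>

theorem theorem4p2: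
  fixes M :: "'a::metric_space measure"
    and F :: "('a \<Rightarrow> real) set"
    and E :: "('a \<Rightarrow> real) \<Rightarrow> ('a \<Rightarrow> real) \<Rightarrow> real"
    and \<Gamma> :: "('a \<Rightarrow> real) \<Rightarrow> ('a \<Rightarrow> real) \<Rightarrow> 'a set \<Rightarrow> real"
    and tensor :: "('a \<Rightarrow> real) \<Rightarrow> ('a \<Rightarrow> real) \<Rightarrow> 'h::{real_inner, complete_space}"
    and D :: "('a \<Rightarrow> real) \<Rightarrow> 'h"
    and b :: "'h \<Rightarrow> 'a \<Rightarrow> real"
    and c :: real
  assumes "locally_compact_space (euclidean :: 'a topology)"
    and "separable_space (euclidean :: 'a topology)"
    and "radon_measure M"
    and "\<And>U. open U \<Longrightarrow> U \<noteq> {} \<Longrightarrow> emeasure M U > 0"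
    and "dirichlet_form M F E"
    and "regular_form M F E"
    and "energy_measures F E \<Gamma>"
    and "\<And>g h. g \<in> core F \<Longrightarrow> h \<in> core F \<Longrightarrow> \<Gamma> g h UNIV = E g h"
    and "is_H_completion F \<Gamma> tensor"
    and "is_gradient M F tensor D"
    and b_L2: "\<And>v. b v \<in> L2 M"
    and b_continuous: "L2_continuous_on M (D ` F) b"
    and "c > 0"
    and b_growth: "\<And>v. v \<in> D ` F \<Longrightarrow> L2_norm M (b v) \<le> c * (1 + norm v)"
    and "compactly_embedded M F E"
  shows "\<exists>\<rho>\<^sub>0>0. \<forall>\<rho>\<ge>\<rho>\<^sub>0. \<exists>u. weak_solution M F E D b \<rho> u"
proof -
  interpret isometric_gradient M F E D
  proof
    show "dirichlet_form M F E" "compactly_embedded M F E" by fact+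
    show "(norm (D u))\<^sup>2 = E u u" if "u \<in> F" for u
      by (rule gradient_isometry[OF assms(5-10) that])
    show "D (\<lambda>x. u x + v x) = D u + D v" if "u \<in> F" "v \<in> F" for u v
      using assms(10) that unfolding is_gradient_def by blast
    show "D (\<lambda>x. r * u x) = r *\<^sub>R D u" if "u \<in> F" for u r
      using assms(10) that unfolding is_gradient_def by blast
  qed
  have "\<forall>\<rho>\<ge>c\<^sup>2. \<exists>u. weak_solution M F E D b \<rho> u"
    using weak_solution_exists[OF b_L2 b_continuous \<open>c > 0\<close> b_growth] by blast
  moreover have "c\<^sup>2 > 0" using \<open>c > 0\<close> by simp
  ultimately show ?thesis by blast
qed

end
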